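(* Let $\Bbbk$ be a field, $n\ge2$, $q\in\Bbbk$ a primitive $n$-th root of unity, $T_n(q)$ the Taft algebra and $A$ a unital associative $\Bbbk$-algebra. Let $\rho:A\to A\otimes T_n(q)$ be a linear map, written $\rho(a)=a^0\otimes a^1$, and for $0\le i<n$ set $A_i=\sum_{r=0}^{n-1}q^{-ir}(g^r)^*(1^1)1^0\in A$; put $w=\sum_{k=0}^{n-1}q^{-k}(g^kx)^*(1^1)1^0\in A$, and write $\rho(w)=w^0\otimes w^1$. Suppose $A_1\in\{0,1_A\}$. Then $\rho$ is a partial coaction of $T_n(q)$ on $A$ if and only if either $\rho$ is a global coaction, or $(I\otimes\pi)\rho:A\to A\otimes\Bbbk C_n$ is a partial coaction of $\Bbbk C_n$ on $A$ with $A_1=0$ and (i) for all $a\in A$, $\rho(a)=\sum_{i,j=0}^{n-1}\sum_{k=0}^{j}q^{-ij}(-1)^kq^{-\frac{k(k-1)}{2}}\binom{j}{k}_{q^{-1}}w^{j-k}\Big(\sum_{t=0}^{n-1}q^{-(i+k)t}(g^t)^*(a^1)a^0\Big)w^k\otimes\frac{1}{n}((j)_q!)^{-1}q^{ij+\frac{j(j-1)}{2}}\sum_{\ell=0}^{n-1}q^{\ell(i+j)}g^\ell x^j$; (ii) $w^n\in Z(A)$; (iii) for all $0\le i<n$, $\sum_{s=0}^{n-1}q^{-is}(g^s)^*(w^1)w^0=q^{-i}A_iw$.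
   Context: The Taft algebra $T_n(q)$ is the Hopf algebra generated by $g,x$ with relations $g^n=1$, $x^n=0$, $xg=qgx$, basis $\{g^ix^j:0\le i,j<n\}$, $g$ group-like, $\Delta(x)=x\otimes1+g\otimes x$, $\varepsilon(x)=0$. $\{(g^ix^j)^*\}$ denotes the dual basis of the basis $\{g^ix^j\}$. $\Bbbk C_n=\mathrm{span}\{1,g,\dots,g^{n-1}\}$ is the group Hopf algebra of the cyclic group $C_n=\langle g\rangle$, and $\pi:T_n(q)\to\Bbbk C_n$ is the linear projection $\pi(g^ix^j)=\delta_{j,0}g^i$. $Z(A)$ is the center of $A$. $q$-numbers: $(m)_q=\sum_{\ell=0}^{m-1}q^\ell$, $(0)_q!=1$, $(m)_q!=(m)_q(m-1)_q!$. $q$-binomials: $\binom{0}{0}_p=1$, $\binom{N}{m}_p=0$ if $m>N$ or $m<0$, and $\binom{N}{m}_p=\binom{N-1}{m-1}_p+p^m\binom{N-1}{m}_p$ for $N\ge1$, $0\le m\le N$. For a bialgebra $H$, a partial coaction of $H$ on $A$ is a linear map $\rho:A\to A\otimes H$ such that $(I\otimes\varepsilon)\rho(a)=a$, $\rho(ab)=\rho(a)\rho(b)$ and $(\rho\otimes I)\rho(a)=(\rho(1_A)\otimes 1_H)((I\otimes\Delta)\rho(a))$ for all $a,b\in A$; it is a global coaction if moreover $\rho(1_A)=1_A\otimes1_H$ (i.e. $A$ is an $H$-comodule algebra). *)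

theory Defs
  imports Main "HOL-Library.Function_Algebras"
begin

definition k_algebra :: "('k::field \<Rightarrow> 'a::{ring,monoid_mult} \<Rightarrow> 'a) \<Rightarrow> bool" where
  "k_algebra sc \<longleftrightarrow>
     (\<forall>c a b. sc c (a + b) = sc c a + sc c b) \<and>
     (\<forall>c d a. sc (c + d) a = sc c a + sc d a) \<and>
     (\<forall>c d a. sc (c * d) a = sc c (sc d a)) \<and>
     (\<forall>a. sc 1 a = a) \<and>
     (\<forall>c a b. sc c (a * b) = sc c a * b) \<and>
     (\<forall>c a b. sc c (a * b) = a * sc c b)"

text \<open>Elements of A \<otimes> H, for a Hopf algebra/bialgebra H with a basis indexed by a finite
 set B :: 'b set, are represented by their coefficient functions 'b \<Rightarrow> 'a
 (u = \<Sum>_{b\<in>B} u b \<otimes> b). An element h of H is represented by its coordinates 'b \<Rightarrow> 'k.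
 The bialgebra is given by structure constants:
   b1 b2 = \<Sum>_b mu b1 b2 b \<cdot> b,  \<Delta>(e) = \<Sum>_{d1,d2} delta e d1 d2 \<cdot> d1 \<otimes> d2,
   \<epsilon>(b) = eps b,  1_H = \<Sum>_b one b \<cdot> b.\<close>

definition tensor :: "('k \<Rightarrow> 'a \<Rightarrow> 'a) \<Rightarrow> 'a \<Rightarrow> ('b \<Rightarrow> 'k) \<Rightarrow> ('b \<Rightarrow> 'a)" where
  "tensor sc a h = (\<lambda>b. sc (h b) a)"

definition partial_coaction ::
  "('k::field \<Rightarrow> 'a::{ring,monoid_mult} \<Rightarrow> 'a) \<Rightarrow> 'b set \<Rightarrow> ('b \<Rightarrow> 'b \<Rightarrow> 'b \<Rightarrow> 'k) \<Rightarrow>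
   ('b \<Rightarrow> 'b \<Rightarrow> 'b \<Rightarrow> 'k) \<Rightarrow> ('b \<Rightarrow> 'k) \<Rightarrow> ('b \<Rightarrow> 'k) \<Rightarrow> ('a \<Rightarrow> 'b \<Rightarrow> 'a) \<Rightarrow> bool" where
  "partial_coaction sc B mu delta eps one \<rho> \<longleftrightarrow>
     \<comment> \<open>(I \<otimes> \<epsilon>) \<rho>(a) = a\<close>
     (\<forall>a. (\<Sum>b\<in>B. sc (eps b) (\<rho> a b)) = a) \<and>
     \<comment> \<open>\<rho>(ac) = \<rho>(a) \<rho>(c) in A \<otimes> H\<close>
     (\<forall>a c. \<forall>b\<in>B. \<rho> (a * c) b = (\<Sum>b1\<in>B. \<Sum>b2\<in>B. sc (mu b1 b2 b) (\<rho> a b1 * \<rho> c b2))) \<and>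
     \<comment> \<open>(\<rho> \<otimes> I)\<rho>(a) = (\<rho>(1) \<otimes> 1_H)((I \<otimes> \<Delta>)\<rho>(a)), coefficient of b1 \<otimes> b2\<close>
     (\<forall>a. \<forall>b1\<in>B. \<forall>b2\<in>B. \<rho> (\<rho> a b2) b1 =
        (\<Sum>c1\<in>B. \<Sum>c2\<in>B. \<Sum>d1\<in>B. \<Sum>d2\<in>B. \<Sum>e\<in>B.
           sc (one c2 * delta e d1 d2 * mu c1 d1 b1 * mu c2 d2 b2) (\<rho> 1 c1 * \<rho> a e)))"

definition global_coaction ::
  "('k::field \<Rightarrow> 'a::{ring,monoid_mult} \<Rightarrow> 'a) \<Rightarrow> 'b set \<Rightarrow> ('b \<Rightarrow> 'b \<Rightarrow> 'b \<Rightarrow> 'k) \<Rightarrow>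
   ('b \<Rightarrow> 'b \<Rightarrow> 'b \<Rightarrow> 'k) \<Rightarrow> ('b \<Rightarrow> 'k) \<Rightarrow> ('b \<Rightarrow> 'k) \<Rightarrow> ('a \<Rightarrow> 'b \<Rightarrow> 'a) \<Rightarrow> bool" where
  "global_coaction sc B mu delta eps one \<rho> \<longleftrightarrow>
     partial_coaction sc B mu delta eps one \<rho> \<and> (\<forall>b\<in>B. \<rho> 1 b = sc (one b) 1)"

definition qnum :: "'k::field \<Rightarrow> nat \<Rightarrow> 'k" where
  "qnum q m = (\<Sum>l<m. q ^ l)"

fun qfact :: "'k::field \<Rightarrow> nat \<Rightarrow> 'k" where
  "qfact q 0 = 1"
| "qfact q (Suc m) = qnum q (Suc m) * qfact q m"

fun qbinom :: "'k::field \<Rightarrow> nat \<Rightarrow> nat \<Rightarrow> 'k" where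
  "qbinom p 0 m = (if m = 0 then 1 else 0)"
| "qbinom p (Suc N) m =
     (if m > Suc N then 0
      else (if m = 0 then 0 else qbinom p N (m - 1)) + p ^ m * qbinom p N m)"

section \<open>The Taft algebra T_n(q), basis g^i x^j indexed by (i,j), 0 \<le> i,j < n\<close>

definition taft_basis :: "nat \<Rightarrow> (nat \<times> nat) set" where
  "taft_basis n = {..<n} \<times> {..<n}"

text \<open>(g^i1 x^j1)(g^i2 x^j2) = q^(j1 i2) g^(i1+i2) x^(j1+j2) (zero if j1+j2 \<ge> n), as x g = q g x.\<close>
definition taft_mu :: "nat \<Rightarrow> 'k::field \<Rightarrow> nat \<times> nat \<Rightarrow> nat \<times> nat \<Rightarrow> nat \<times> nat \<Rightarrow> 'k" where
  "taft_mu n q b1 b2 b = (case (b1, b2, b) of ((i1, j1), (i2, j2), (i, j)) \<Rightarrow>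
     if j1 + j2 = j \<and> j < n \<and> (i1 + i2) mod n = i then q ^ (j1 * i2) else 0)"

text \<open>\<Delta>(g^i x^j) = \<Sum>_{m=0}^{j} binom(j,m)_q g^(i+m) x^(j-m) \<otimes> g^i x^m.\<close>
definition taft_delta :: "nat \<Rightarrow> 'k::field \<Rightarrow> nat \<times> nat \<Rightarrow> nat \<times> nat \<Rightarrow> nat \<times> nat \<Rightarrow> 'k" where
  "taft_delta n q e d1 d2 = (case (e, d1, d2) of ((i, j), (i1, j1), (i2, j2)) \<Rightarrow>
     if i2 = i \<and> j1 + j2 = j \<and> i1 = (i + j2) mod n then qbinom q j j2 else 0)"

definition taft_eps :: "nat \<times> nat \<Rightarrow> 'k::field" where
  "taft_eps b = (if snd b = 0 then 1 else 0)"

definition taft_one :: "nat \<times> nat \<Rightarrow> 'k::field" where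
  "taft_one b = (if b = (0, 0) then 1 else 0)"

section \<open>The group algebra k C_n, basis g^i indexed by i, 0 \<le> i < n\<close>

definition cyc_mu :: "nat \<Rightarrow> nat \<Rightarrow> nat \<Rightarrow> nat \<Rightarrow> 'k::field" where
  "cyc_mu n i1 i2 i = (if (i1 + i2) mod n = i then 1 else 0)"

definition cyc_delta :: "nat \<Rightarrow> nat \<Rightarrow> nat \<Rightarrow> 'k::field" where
  "cyc_delta e d1 d2 = (if d1 = e \<and> d2 = e then 1 else 0)"

definition cyc_eps :: "nat \<Rightarrow> 'k::field" where
  "cyc_eps i = 1"

definition cyc_one :: "nat \<Rightarrow> 'k::field" where
  "cyc_one i = (if i = 0 then 1 else 0)"

text \<open>(I \<otimes> \<pi>)\<rho> : A \<rightarrow> A \<otimes> k C_n, where \<pi>(g^i x^j) = \<delta>_{j,0} g^i.\<close>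
definition proj_pi :: "('a \<Rightarrow> nat \<times> nat \<Rightarrow> 'a) \<Rightarrow> 'a \<Rightarrow> nat \<Rightarrow> 'a" where
  "proj_pi \<rho> a i = \<rho> a (i, 0)"

end

theory Submission
  imports Defs "HOL-Computational_Algebra.Polynomial"
begin

text \<open>
  A partial coaction of \<open>T\<^sub>n(q)\<close> is a partial action of the dual Hopf algebra. The latter is again a
  Taft algebra, generated by the character \<open>G\<close> with \<open>G(g) = q\<^sup>-\<^sup>1\<close>, \<open>G(x) = 0\<close> and a
  \<open>(1, G)\<close>-skew-primitive \<open>X\<close> with \<open>X G = q G X\<close>; here \<open>A\<^sub>i = G\<^sup>i \<cdot> 1\<close> and \<open>w = X \<cdot> 1\<close>. Passing to the
  dual is a discrete Fourier transform in the powers of \<open>g\<close>.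

  If \<open>A\<^sub>1 = 1\<close>, then \<open>X \<cdot> (G \<cdot> 1) = w + X G \<cdot> 1\<close> forces \<open>w = 0\<close> and the action is global. If \<open>A\<^sub>1 = 0\<close>, then
  \<open>X G\<^sup>-\<^sup>1 \<cdot> b = - b w\<close>, and applying \<open>X G\<^sup>-\<^sup>1\<close> to \<open>G k \<cdot> a\<close> yields the recursion
  \<open>X k \<cdot> a = w (k \<cdot> a) - (G k \<cdot> a) w\<close>. Its solution is (i), the relation \<open>X\<^sup>n = 0\<close> is (ii), and (iii)
  computes \<open>G\<^sup>i \<cdot> (X \<cdot> 1)\<close>. Conversely, solutions of the recursion are closed under convolution and are
  determined by their values on the powers of \<open>G\<close>, so multiplicativity and the partial action law
  propagate from \<open>kC\<^sub>n\<close> to the whole algebra.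
\<close>

section \<open>q-binomials and roots of unity\<close>

lemma one_minus_times_qnum: "(1 - q) * qnum q m = 1 - q ^ m"
  unfolding qnum_def by (simp add: one_diff_power_eq)

lemma qnum_0 [simp]: "qnum q 0 = 0"
  by (simp add: qnum_def)

lemma qnum_Suc: "qnum q (Suc m) = qnum q m + q ^ m"
  by (simp add: qnum_def)

lemma qnum_add: "qnum q (a + b) = q ^ b * qnum q a + qnum q b"
  by (induction a) (simp_all add: qnum_Suc algebra_simps power_add)

lemma qbinom_eq_0: "N < k \<Longrightarrow> qbinom p N k = 0"
  by (cases N) auto

lemma qbinom_0_right [simp]: "qbinom p N 0 = 1"
  by (induction N) auto

lemma qbinom_self [simp]: "qbinom p N N = 1"
  by (induction N) (auto simp: qbinom_eq_0)

lemma qbinom_Suc_Suc: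
  "qbinom p (Suc N) (Suc k) = qbinom p N k + p ^ Suc k * qbinom p N (Suc k)"
  by (auto simp: qbinom_eq_0)

text \<open>The recursion defining \<open>qbinom\<close> is one of the two q-Pascal rules; this is
  the other one, with the power of \<open>p\<close> on the lower column. Its proof expands by the
  first rule, uses induction in both columns and regroups by the first rule again.\<close>

lemma qbinom_Suc_Suc':
  assumes "k \<le> N"
  shows "qbinom p (Suc N) (Suc k) = p ^ (N - k) * qbinom p N k + qbinom p N (Suc k)"
  using assms
proof (induction N arbitrary: k)
  case 0
  then show ?case by simp
next
  case (Suc N)
  consider "k = Suc N" | "k = 0" | l where "k = Suc l" "k \<le> N"
    using Suc.prems by (metis le_SucE not0_implies_Suc)
  then show ?case
  proof cases
    case 1
    then show ?thesis by (simp add: qbinom_eq_0 del: qbinom.simps)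
  next
    case 2
    have "qbinom p (Suc (Suc N)) (Suc 0) = 1 + p * qbinom p (Suc N) (Suc 0)"
      by (subst qbinom_Suc_Suc) simp
    also have "\<dots> = 1 + p * (p ^ N + qbinom p N (Suc 0))"
      by (subst Suc.IH) simp_all
    also have "\<dots> = p ^ Suc N + (1 + p * qbinom p N (Suc 0))"
      by (simp add: algebra_simps)
    also have "\<dots> = p ^ Suc N + qbinom p (Suc N) (Suc 0)"
      by (subst qbinom_Suc_Suc) simp
    finally show ?thesis using 2 by simp
  next
    case 3
    have pk: "p ^ Suc k * p ^ (N - k) = p ^ Suc N" and pl: "p ^ (N - l) * p ^ k = p ^ Suc N"
      using 3 by (simp_all flip: power_add power_Suc)
    have "qbinom p (Suc (Suc N)) (Suc k) = qbinom p (Suc N) k + p ^ Suc k * qbinom p (Suc N) (Suc k)"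
      by (rule qbinom_Suc_Suc)
    also have "qbinom p (Suc N) k = p ^ (N - l) * qbinom p N l + qbinom p N k"
      using 3 by (simp only: Suc.IH)
    also have "p ^ Suc k * qbinom p (Suc N) (Suc k)
        = p ^ Suc N * qbinom p N k + p ^ Suc k * qbinom p N (Suc k)"
      by (simp only: Suc.IH[OF 3(2)] distrib_left pk flip: mult.assoc)
    also have "p ^ (N - l) * qbinom p N l + qbinom p N k
          + (p ^ Suc N * qbinom p N k + p ^ Suc k * qbinom p N (Suc k))
        = p ^ (N - l) * (qbinom p N l + p ^ k * qbinom p N k)
          + (qbinom p N k + p ^ Suc k * qbinom p N (Suc k))"
      by (simp add: distrib_left pl flip: mult.assoc del: qbinom.simps power_Suc)
    also have "\<dots> = p ^ (N - l) * qbinom p (Suc N) k + qbinom p (Suc N) (Suc k)"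
      using 3 by (simp only: qbinom_Suc_Suc)
    finally show ?thesis using 3 by (simp add: Suc_diff_Suc del: qbinom.simps)
  qed
qed

text \<open>Subtract the two q-Pascal rules. This relates neighbouring columns without quotients of
  q-factorials, so it remains valid at roots of unity.\<close>

lemma qbinom_absorb:
  assumes "k \<le> N"
  shows "(1 - p ^ Suc k) * qbinom p N (Suc k) = (1 - p ^ (N - k)) * qbinom p N k"
  using qbinom_Suc_Suc[of p N k] qbinom_Suc_Suc'[OF assms, of p]
  by (simp add: algebra_simps del: qbinom.simps)

text \<open>A quotient-free form of the factorial formula: after multiplication by
  \<open>1 - p\<close> it follows from one q-Pascal rule and \<open>qbinom_absorb\<close>. The
  condition on \<open>p\<close> allows \<open>1 - p\<close> to be cancelled again.\<close>

lemma qnum_times_qbinom: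
  assumes "p \<noteq> 1"
  shows "qnum p (Suc t) * qbinom p (Suc t + k) k = qnum p (Suc t + k) * qbinom p (t + k) k"
proof -
  have "(1 - p ^ Suc t) * qbinom p (Suc t + k) k = (1 - p ^ (Suc t + k)) * qbinom p (t + k) k"
  proof (cases k)
    case 0
    then show ?thesis by simp
  next
    case (Suc l)
    let ?c = "qbinom p (t + k) k"
    have a: "(1 - p ^ k) * ?c = (1 - p ^ Suc t) * qbinom p (t + k) l"
      using qbinom_absorb[of l "t + k" p] Suc by simp
    have "(1 - p ^ Suc t) * qbinom p (Suc t + k) k
        = (1 - p ^ Suc t) * (qbinom p (t + k) l + p ^ k * ?c)"
      using Suc by (simp only: add_Suc add_Suc_right qbinom_Suc_Suc)
    also have "\<dots> = (1 - p ^ k) * ?c + (1 - p ^ Suc t) * p ^ k * ?c"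
      by (simp only: distrib_left a mult.assoc)
    also have "\<dots> = (1 - p ^ (Suc t + k)) * ?c"
      by (simp add: algebra_simps power_add)
    finally show ?thesis .
  qed
  then have "(1 - p) * (qnum p (Suc t) * qbinom p (Suc t + k) k)
      = (1 - p) * (qnum p (Suc t + k) * qbinom p (t + k) k)"
    by (simp only: one_minus_times_qnum flip: mult.assoc)
  then show ?thesis using assms by (simp del: qbinom.simps)
qed

section \<open>Arithmetic of a primitive n-th root of unity\<close>

locale root_of_unity =
  fixes n :: nat and q :: "'k::field"
  assumes n2: "2 \<le> n" and q_pow: "q ^ n = 1"
    and q_prim: "\<And>m. 0 < m \<Longrightarrow> m < n \<Longrightarrow> q ^ m \<noteq> 1"
begin

lemma q_nz [simp]: "q \<noteq> 0"
  using q_pow n2 by (auto simp: zero_power)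

lemma q_neq_1: "q \<noteq> 1"
  using q_prim[of 1] n2 by auto

lemma n_pos [simp]: "0 < n"
  using n2 by simp

lemma power_q_inj:
  assumes "q ^ a = q ^ b" "a < n" "b < n"
  shows "a = b"
proof -
  have *: "a = b" if "q ^ a = q ^ b" "b < n" "a \<le> b" for a b
  proof (rule ccontr)
    assume "a \<noteq> b"
    with that have "0 < b - a" "b - a < n" by auto
    moreover have "q ^ a * q ^ (b - a) = q ^ b"
      using that power_add[of q a "b - a"] by simp
    with that have "q ^ a * q ^ (b - a) = q ^ a * 1" by simp
    then have "q ^ (b - a) = 1" by simp
    ultimately show False using q_prim by blast
  qed
  show ?thesis using *[of a b] *[of b a] assms by (cases "a \<le> b") auto
qed

lemma qnum_nz: "0 < m \<Longrightarrow> m < n \<Longrightarrow> qnum q m \<noteq> 0"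
  using one_minus_times_qnum[of q m] q_prim[of m] by auto

lemma qfact_nz: "j < n \<Longrightarrow> qfact q j \<noteq> 0"
  by (induction j) (auto simp: qnum_nz)

text \<open>The polynomial \<open>1 + X + \<dots> + X\<^sup>n\<^sup>-\<^sup>1\<close> vanishes at the powers of \<open>q\<close> other than
  \<open>1\<close>; if \<open>n\<close> were zero in the field it would vanish at \<open>1\<close> as well and have too many roots.\<close>
lemma of_nat_n_nz: "(of_nat n :: 'k) \<noteq> 0"
proof
  assume n0: "(of_nat n :: 'k) = 0"
  define p :: "'k poly" where "p = (\<Sum>l<n. monom 1 l)"
  have coeff: "coeff p l = (if l < n then 1 else 0)" for l
    by (simp add: p_def coeff_sum)
  have "p \<noteq> 0" using coeff[of 0] n2 by auto
  have deg: "degree p \<le> n - 1"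
    by (rule degree_le) (auto simp: coeff)
  have "poly p (q ^ i) = 0" if "i < n" for i
  proof -
    have p: "poly p x = (\<Sum>l<n. x ^ l)" for x
      by (simp add: p_def poly_sum poly_monom)
    show ?thesis
    proof (cases "i = 0")
      case True
      then show ?thesis using n0 by (simp add: p)
    next
      case False
      have "(1 - q ^ i) * poly p (q ^ i) = 1 - (q ^ i) ^ n"
        by (simp add: p one_diff_power_eq)
      also have "(q ^ i) ^ n = 1"
        by (metis power_mult mult.commute q_pow power_one)
      finally show ?thesis using q_prim[of i] False that by auto
    qed
  qed
  then have "(\<lambda>i. q ^ i) ` {..<n} \<subseteq> {x. poly p x = 0}" by auto
  then have "card ((\<lambda>i. q ^ i) ` {..<n}) \<le> card {x. poly p x = 0}"
    by (rule card_mono[OF poly_roots_finite[OF \<open>p \<noteq> 0\<close>]])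
  moreover have "card ((\<lambda>i. q ^ i) ` {..<n}) = n"
    by (subst card_image) (auto intro: inj_onI power_q_inj)
  moreover have "card {x. poly p x = 0} \<le> degree p"
    by (rule card_poly_roots_bound) fact
  ultimately show False using deg n2 by linarith
qed

lemma powi_add: "q powi (a + b) = q powi a * q powi b"
  by (simp add: power_int_add)

lemma powi_cong:
  assumes "a mod int n = b mod int n"
  shows "q powi a = q powi b"
proof -
  from assms obtain k where "a = b + int n * k"
    by (metis mod_eqE mult.commute)
  then show ?thesis
    by (simp add: powi_add power_int_mult q_pow)
qed

lemma powi_mod: "q powi (m * int (l mod n)) = q powi (m * int l)"
  by (rule powi_cong) (simp add: zmod_int mod_mult_right_eq)

text \<open>Orthogonality of the characters of the cyclic group: for distinct \<open>l\<close> and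
  \<open>r\<close> the terms are powers of an n-th root of unity other than 1, whose geometric sum
  vanishes.\<close>

lemma sum_powi:
  assumes "l < n" "r < n"
  shows "(\<Sum>i<n. q powi (int i * (int l - int r))) = (if l = r then of_nat n else 0)"
proof (cases "l = r")
  case False
  define x where "x = q powi (int l - int r)"
  have "x * q ^ r = q ^ l"
    by (simp add: x_def power_int_diff)
  then have "x \<noteq> 1" using power_q_inj assms False by auto
  have "x ^ n = (q ^ n) powi (int l - int r)"
    by (simp add: x_def power_int_power power_int_power' mult.commute)
  then have "(1 - x) * (\<Sum>i<n. x ^ i) = 0"
    by (simp flip: one_diff_power_eq add: q_pow)
  then show ?thesis
    using False \<open>x \<noteq> 1\<close> by (simp add: x_def power_int_power' mult.commute)
qed simp

text \<open>For even \<open>n\<close> the power q^(n/2) is a square root of 1 other than 1, hence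
  -1; for odd \<open>n\<close> the exponent n(n-1)/2 is a multiple of \<open>n\<close>. The value is
  the last coefficient of \<open>skew_form\<close> at level \<open>n\<close>.\<close>

lemma powi_triangle: "(-1) ^ n * q powi (- int (n * (n - 1) div 2)) = -1"
proof (cases "even n")
  case True
  then obtain h where h: "n = 2 * h" by blast
  with n2 have "0 < h" "h < n" by auto
  have "(q ^ h - 1) * (q ^ h + 1) = 0"
    using q_pow power_add[of q h h] by (simp only: h mult_2) (simp add: algebra_simps)
  then have "q ^ h = -1"
    using q_prim[OF \<open>0 < h\<close> \<open>h < n\<close>] by (auto simp: eq_neg_iff_add_eq_0)
  moreover have "q ^ (n * (n - 1) div 2) = (q ^ h) ^ (n - 1)"
    by (simp add: h mult.assoc power_mult)
  moreover have "odd (n - 1)" using True n2 by auto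
  ultimately show ?thesis using True by (simp add: power_int_minus)
next
  case False
  then have "even (n - 1)" by simp
  then obtain h where "n - 1 = 2 * h" by blast
  then have "n * (n - 1) div 2 = n * h" by simp
  then have "q ^ (n * (n - 1) div 2) = 1" by (simp only: power_mult q_pow power_one)
  then have "q powi (- int (n * (n - 1) div 2)) = 1"
    by (simp only: power_int_minus power_int_of_nat inverse_1)
  then show ?thesis using False by simp
qed

text \<open>Climb the columns with \<open>qbinom_absorb\<close>: the factor 1 - q^(-n) kills column
  1, and each later column inherits the zero because 1 - q^(-k) is nonzero for 0 < k < n.\<close>

lemma qbinom_n:
  assumes "0 < k" "k < n"
  shows "qbinom (inverse q) n k = 0"
  using assms
proof (induction k)
  case (Suc k)
  have "inverse q ^ Suc k \<noteq> 1"
    using q_prim[of "Suc k"] Suc.prems by (simp add: power_inverse del: power_Suc)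
  moreover have "(1 - inverse q ^ (n - k)) * qbinom (inverse q) n k = 0"
    using Suc by (cases "k = 0") (simp_all add: power_inverse q_pow)
  then have "(1 - inverse q ^ Suc k) * qbinom (inverse q) n (Suc k) = 0"
    using Suc.prems by (simp only: qbinom_absorb Suc_leD less_imp_le)
  ultimately show ?case by simp
qed simp

end

section \<open>Fourier transform of elements of A \<otimes> T\<close>

locale taft_scalars = root_of_unity n q + vector_space sc
  for n :: nat and q :: "'k::field" and sc :: "'k \<Rightarrow> 'a::{ring,monoid_mult} \<Rightarrow> 'a" +
  assumes sc_mult_left: "sc c a * b = sc c (a * b)"
    and sc_mult_right: "a * sc c b = sc c (a * b)"
begin

text \<open>Frequencies are integers, with period \<open>n\<close> by \<open>dft_cong_mod\<close>,
  so that shifts such as \<open>m - int s\<close> need no reduction.\<close>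

definition dft :: "(nat \<Rightarrow> 'a) \<Rightarrow> int \<Rightarrow> 'a" where
  "dft u m = (\<Sum>l<n. sc (q powi (- (m * int l))) (u l))"

lemma dft_cong_mod:
  assumes "m mod int n = m' mod int n"
  shows "dft u m = dft u m'"
  unfolding dft_def
proof (intro sum.cong refl arg_cong2[where f = sc] powi_cong)
  fix l
  show "- (m * int l) mod int n = - (m' * int l) mod int n"
    using assms by (intro mod_minus_cong mod_mult_cong) auto
qed

text \<open>Orthogonality together with the invertibility of \<open>n\<close> in the field. The
  offset \<open>c\<close> selects any window of \<open>n\<close> consecutive frequencies; formula
  (i) uses the window starting at \<open>j\<close>.\<close>

lemma dft_inverse:
  assumes "l < n"
  shows "u l = sc (inverse (of_nat n))
    (\<Sum>i<n. sc (q powi ((int i + c) * int l)) (dft u (int i + c)))"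
proof -
  have "(\<Sum>i<n. sc (q powi ((int i + c) * int l)) (dft u (int i + c)))
      = (\<Sum>i<n. \<Sum>r<n. sc (q powi (int i * (int l - int r)) * q powi (c * (int l - int r))) (u r))"
    unfolding dft_def
    by (intro sum.cong refl) (simp add: scale_sum_right algebra_simps flip: powi_add)
  also have "\<dots> = (\<Sum>r<n. sc ((\<Sum>i<n. q powi (int i * (int l - int r))) * q powi (c * (int l - int r))) (u r))"
    by (subst sum.swap) (simp add: scale_sum_left sum_distrib_right)
  also have "\<dots> = (\<Sum>r<n. if r = l then sc (of_nat n) (u r) else 0)"
    using assms by (intro sum.cong refl) (auto simp: sum_powi)
  also have "\<dots> = sc (of_nat n) (u l)"
    using assms by simp
  finally show ?thesis by (simp add: of_nat_n_nz)
qed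

lemma dft_eq_iff: "(\<forall>m. dft u m = dft v m) \<longleftrightarrow> (\<forall>l<n. u l = v l)"
proof
  assume "\<forall>m. dft u m = dft v m"
  then show "\<forall>l<n. u l = v l"
    using dft_inverse[of _ u 0] dft_inverse[of _ v 0] by simp
qed (simp add: dft_def)

text \<open>The twist q^(s l2) comes from moving x^s past g^l2. A Fourier transform turns the cyclic
  convolution into a product and the twist into a shift of the second frequency by
  \<open>s\<close>.\<close>

lemma dft_mult:
  "dft (\<lambda>l. \<Sum>l1<n. \<Sum>l2<n. if (l1 + l2) mod n = l then sc (q ^ (s * l2)) (u l1 * v l2) else 0) m
    = dft u m * dft v (m - int s)"
proof -
  have "dft (\<lambda>l. \<Sum>l1<n. \<Sum>l2<n. if (l1 + l2) mod n = l then sc (q ^ (s * l2)) (u l1 * v l2) else 0) m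
     = (\<Sum>l<n. \<Sum>l1<n. \<Sum>l2<n. if l = (l1 + l2) mod n
          then sc (q powi (- (m * int l))) (sc (q ^ (s * l2)) (u l1 * v l2)) else 0)"
    unfolding dft_def by (auto simp: scale_sum_right intro!: sum.cong)
  also have "\<dots> = (\<Sum>l1<n. \<Sum>l2<n. \<Sum>l<n. if l = (l1 + l2) mod n
          then sc (q powi (- (m * int l))) (sc (q ^ (s * l2)) (u l1 * v l2)) else 0)"
    by (subst sum.swap) (rule sum.cong[OF refl], rule sum.swap)
  also have "\<dots> = (\<Sum>l1<n. \<Sum>l2<n.
      sc (q powi (- (m * int ((l1 + l2) mod n)))) (sc (q ^ (s * l2)) (u l1 * v l2)))"
    by (simp add: sum.delta)
  also have "\<dots> = (\<Sum>l1<n. \<Sum>l2<n.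
      sc (q powi (- (m * int l1))) (u l1) * sc (q powi (- ((m - int s) * int l2))) (v l2))"
  proof (intro sum.cong refl)
    fix l1 l2
    have "q powi (- (m * int ((l1 + l2) mod n))) = q powi (- m * int (l1 + l2))"
      using powi_mod[of "- m" "l1 + l2"] by simp
    then have "q powi (- (m * int ((l1 + l2) mod n))) * q ^ (s * l2)
        = q powi (- m * int (l1 + l2)) * q powi int (s * l2)"
      by (simp only: power_int_of_nat)
    also have "\<dots> = q powi (- (m * int l1)) * q powi (- ((m - int s) * int l2))"
      unfolding powi_add[symmetric] by (simp add: algebra_simps)
    finally show "sc (q powi (- (m * int ((l1 + l2) mod n)))) (sc (q ^ (s * l2)) (u l1 * v l2))
      = sc (q powi (- (m * int l1))) (u l1) * sc (q powi (- ((m - int s) * int l2))) (v l2)"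
      by (simp add: sc_mult_left sc_mult_right mult.commute)
  qed
  finally show ?thesis by (simp add: dft_def sum_product)
qed

section \<open>Product and coproduct of the Taft algebra in Fourier coordinates\<close>

definition hat :: "(nat \<times> nat \<Rightarrow> 'a) \<Rightarrow> int \<Rightarrow> nat \<Rightarrow> 'a" where
  "hat u m j = dft (\<lambda>l. u (l, j)) m"

lemma sum_taft_basis: "(\<Sum>b\<in>taft_basis n. f b) = (\<Sum>l<n. \<Sum>j<n. f (l, j))"
  unfolding taft_basis_def by (simp add: sum.cartesian_product)

lemma taft_mult_coordinate:
  assumes "j < n"
  shows "(\<Sum>b1\<in>taft_basis n. \<Sum>b2\<in>taft_basis n. sc (taft_mu n q b1 b2 (l, j)) (u b1 * v b2))
    = (\<Sum>s\<le>j. \<Sum>l1<n. \<Sum>l2<n. if (l1 + l2) mod n = l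
        then sc (q ^ (s * l2)) (u (l1, s) * v (l2, j - s)) else 0)"
proof -
  define F where "F l1 l2 s = (if (l1 + l2) mod n = l
        then sc (q ^ (s * l2)) (u (l1, s) * v (l2, j - s)) else 0)" for l1 l2 s
  have *: "(\<Sum>t<n. sc (taft_mu n q (l1, s) (l2, t) (l, j)) (u (l1, s) * v (l2, t)))
      = (if s \<le> j then F l1 l2 s else 0)" for l1 l2 s
  proof -
    have "(\<Sum>t<n. sc (taft_mu n q (l1, s) (l2, t) (l, j)) (u (l1, s) * v (l2, t)))
      = (\<Sum>t<n. if t = j - s then (if s \<le> j then F l1 l2 s else 0) else 0)"
      using assms by (intro sum.cong refl) (auto simp: taft_mu_def F_def)
    moreover have "j - s < n" using assms by simp
    ultimately show ?thesis by simp
  qed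
  have "(\<Sum>b1\<in>taft_basis n. \<Sum>b2\<in>taft_basis n. sc (taft_mu n q b1 b2 (l, j)) (u b1 * v b2))
      = (\<Sum>l1<n. \<Sum>s<n. \<Sum>l2<n. if s \<le> j then F l1 l2 s else 0)"
    by (simp add: sum_taft_basis *)
  also have "\<dots> = (\<Sum>s<n. if s \<le> j then \<Sum>l1<n. \<Sum>l2<n. F l1 l2 s else 0)"
    by (subst sum.swap) (auto intro!: sum.cong)
  also have "\<dots> = (\<Sum>s\<in>{..<n} \<inter> {..j}. \<Sum>l1<n. \<Sum>l2<n. F l1 l2 s)"
    by (simp add: sum.inter_restrict)
  also have "{..<n} \<inter> {..j} = {..j}" using assms by auto
  finally show ?thesis by (simp add: F_def)
qed

lemma dft_sum: "dft (\<lambda>l. \<Sum>s\<in>S. f s l) m = (\<Sum>s\<in>S. dft (f s) m)"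
  unfolding dft_def scale_sum_right by (rule sum.swap)

lemma dft_times_left: "dft (\<lambda>l. x * f l) m = x * dft f m"
  unfolding dft_def by (simp add: sum_distrib_left sc_mult_right)

lemma dft_cong: "(\<And>l. l < n \<Longrightarrow> u l = v l) \<Longrightarrow> dft u m = dft v m"
  by (simp add: dft_def)

lemma hat_mult:
  assumes "j < n"
  shows "hat (\<lambda>b. \<Sum>b1\<in>taft_basis n. \<Sum>b2\<in>taft_basis n. sc (taft_mu n q b1 b2 b) (u b1 * v b2)) m j
    = (\<Sum>s\<le>j. hat u m s * hat v (m - int s) (j - s))"
  unfolding hat_def taft_mult_coordinate[OF assms]
  by (subst dft_sum) (intro sum.cong refl dft_mult)

text \<open>Fixing the second leg and the x-degree of the first leaves only
  \<open>e = (l', t + j')\<close>. When \<open>t + j'\<close> reaches \<open>n\<close> there is no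
  such basis element, and the right side vanishes by the support assumption on
  \<open>y\<close>.\<close>

lemma hat_comult:
  assumes y: "\<And>b. b \<notin> taft_basis n \<Longrightarrow> y b = 0" and "l' < n" "t < n"
  shows "hat (\<lambda>d. \<Sum>e\<in>taft_basis n. sc (taft_delta n q e d (l', j')) (y e)) m t
    = sc (q powi (- (m * int (l' + j'))) * qbinom q (t + j') j') (y (l', t + j'))"
proof -
  have coord: "(\<Sum>e\<in>taft_basis n. sc (taft_delta n q e (l, t) (l', j')) (y e))
      = (if l = (l' + j') mod n then sc (qbinom q (t + j') j') (y (l', t + j')) else 0)" for l
  proof -
    have "(\<Sum>e\<in>taft_basis n. sc (taft_delta n q e (l, t) (l', j')) (y e))
      = (\<Sum>e\<in>taft_basis n. if e = (l', t + j')
          then (if l = (l' + j') mod n then sc (qbinom q (t + j') j') (y (l', t + j')) else 0) else 0)"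
      by (intro sum.cong refl) (auto simp: taft_delta_def split: prod.splits)
    also have "\<dots> = (if l = (l' + j') mod n then sc (qbinom q (t + j') j') (y (l', t + j')) else 0)"
      using y[of "(l', t + j')"] by (auto simp: taft_basis_def)
    finally show ?thesis .
  qed
  have "hat (\<lambda>d. \<Sum>e\<in>taft_basis n. sc (taft_delta n q e d (l', j')) (y e)) m t
    = sc (q powi (- (m * int ((l' + j') mod n)))) (sc (qbinom q (t + j') j') (y (l', t + j')))"
    unfolding hat_def dft_def coord by (simp add: if_distrib[of "sc _"] cong: if_cong)
  also have "q powi (- (m * int ((l' + j') mod n))) = q powi (- (m * int (l' + j')))"
    using powi_mod[of "- m" "l' + j'"] by simp
  finally show ?thesis by simp
qed

text \<open>The unit in the second leg forces \<open>c2 = (0, 0)\<close> and then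
  \<open>d2 = b2\<close>, which collapses the sums over \<open>c2\<close> and
  \<open>d2\<close>.\<close>

lemma taft_coassoc_coordinate:
  assumes "b2 \<in> taft_basis n"
  shows "(\<Sum>c1\<in>taft_basis n. \<Sum>c2\<in>taft_basis n. \<Sum>d1\<in>taft_basis n. \<Sum>d2\<in>taft_basis n.
      \<Sum>e\<in>taft_basis n.
        sc (taft_one c2 * taft_delta n q e d1 d2 * taft_mu n q c1 d1 b1 * taft_mu n q c2 d2 b2)
          (x c1 * y e))
    = (\<Sum>c\<in>taft_basis n. \<Sum>d\<in>taft_basis n. sc (taft_mu n q c d b1)
        (x c * (\<Sum>e\<in>taft_basis n. sc (taft_delta n q e d b2) (y e))))"
proof (rule sum.cong[OF refl])
  let ?B = "taft_basis n"
  fix c1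
  define G where "G d1 d2 = (\<Sum>e\<in>?B. sc (taft_delta n q e d1 d2 * taft_mu n q c1 d1 b1) (x c1 * y e))"
    for d1 d2
  have fin: "finite ?B" and zero: "(0, 0) \<in> ?B"
    by (auto simp: taft_basis_def)
  have mu: "taft_mu n q (0, 0) d b2 = (if d = b2 then 1 else 0)" if "d \<in> ?B" for d
    using that assms by (auto simp: taft_mu_def taft_basis_def split: if_splits)
  have "(\<Sum>c2\<in>?B. \<Sum>d1\<in>?B. \<Sum>d2\<in>?B. \<Sum>e\<in>?B.
        sc (taft_one c2 * taft_delta n q e d1 d2 * taft_mu n q c1 d1 b1 * taft_mu n q c2 d2 b2)
          (x c1 * y e))
      = (\<Sum>c2\<in>?B. if c2 = (0, 0) then \<Sum>d1\<in>?B. \<Sum>d2\<in>?B. \<Sum>e\<in>?B.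
        sc (taft_delta n q e d1 d2 * taft_mu n q c1 d1 b1 * taft_mu n q (0, 0) d2 b2) (x c1 * y e)
        else 0)"
    by (intro sum.cong refl) (simp add: taft_one_def)
  also have "\<dots> = (\<Sum>d1\<in>?B. \<Sum>d2\<in>?B. \<Sum>e\<in>?B.
        sc (taft_delta n q e d1 d2 * taft_mu n q c1 d1 b1 * taft_mu n q (0, 0) d2 b2) (x c1 * y e))"
    using fin zero by simp
  also have "\<dots> = (\<Sum>d1\<in>?B. \<Sum>d2\<in>?B. if d2 = b2 then G d1 d2 else 0)"
    by (intro sum.cong refl) (simp add: mu G_def)
  also have "\<dots> = (\<Sum>d1\<in>?B. G d1 b2)"
    using fin assms by simp
  also have "\<dots> = (\<Sum>d\<in>?B. sc (taft_mu n q c1 d b1)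
        (x c1 * (\<Sum>e\<in>?B. sc (taft_delta n q e d b2) (y e))))"
    by (simp add: G_def sum_distrib_left scale_sum_right sc_mult_right mult.commute)
  finally show "(\<Sum>c2\<in>?B. \<Sum>d1\<in>?B. \<Sum>d2\<in>?B. \<Sum>e\<in>?B.
        sc (taft_one c2 * taft_delta n q e d1 d2 * taft_mu n q c1 d1 b1 * taft_mu n q c2 d2 b2)
          (x c1 * y e))
      = (\<Sum>d\<in>?B. sc (taft_mu n q c1 d b1)
        (x c1 * (\<Sum>e\<in>?B. sc (taft_delta n q e d b2) (y e))))" .
qed

text \<open>The frequencies \<open>m\<close> and \<open>m'\<close> belong to the first and second
  tensor leg. The phase in \<open>l'\<close> produced by \<open>hat_comult\<close> adds to that of
  the second transform, so \<open>y\<close> is evaluated at \<open>m - int s + m'\<close>.\<close>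

lemma hat_coassoc:
  assumes y: "\<And>b. b \<notin> taft_basis n \<Longrightarrow> y b = 0" and j: "j < n" "j' < n"
  shows "dft (\<lambda>l'. hat (\<lambda>b1. \<Sum>c1\<in>taft_basis n. \<Sum>c2\<in>taft_basis n. \<Sum>d1\<in>taft_basis n.
      \<Sum>d2\<in>taft_basis n. \<Sum>e\<in>taft_basis n.
        sc (taft_one c2 * taft_delta n q e d1 d2 * taft_mu n q c1 d1 b1 * taft_mu n q c2 d2 (l', j'))
          (x c1 * y e)) m j) m'
    = (\<Sum>s\<le>j. hat x m s * sc (q powi (- ((m - int s) * int j')) * qbinom q (j - s + j') j')
        (hat y (m - int s + m') (j - s + j')))"
    (is "dft ?L m' = _")
proof -
  have "dft ?L m' = dft (\<lambda>l'. \<Sum>s\<le>j. hat x m s *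
      sc (q powi (- ((m - int s) * int (l' + j'))) * qbinom q (j - s + j') j') (y (l', j - s + j'))) m'"
  proof (rule dft_cong)
    fix l' assume "l' < n"
    then have "(l', j') \<in> taft_basis n" using j by (simp add: taft_basis_def)
    then show "?L l' = (\<Sum>s\<le>j. hat x m s *
      sc (q powi (- ((m - int s) * int (l' + j'))) * qbinom q (j - s + j') j') (y (l', j - s + j')))"
      using \<open>l' < n\<close> j by (simp add: taft_coassoc_coordinate hat_mult hat_comult y)
  qed
  also have "\<dots> = (\<Sum>s\<le>j. hat x m s * sc (q powi (- ((m - int s) * int j')) * qbinom q (j - s + j') j')
        (hat y (m - int s + m') (j - s + j')))"
    unfolding dft_sum dft_times_left
  proof (intro sum.cong refl arg_cong2[where f = "(*)"])
    fix s
    let ?b = "qbinom q (j - s + j') j'"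
    have c: "q powi (- (m' * int l)) * (q powi (- ((m - int s) * int (l + j'))) * ?b)
      = q powi (- ((m - int s) * int j')) * ?b * q powi (- ((m - int s + m') * int l))" for l
    proof -
      have "- (m' * int l) + - ((m - int s) * int (l + j'))
          = - ((m - int s) * int j') + - ((m - int s + m') * int l)"
        by (simp add: algebra_simps)
      then have "q powi (- (m' * int l)) * q powi (- ((m - int s) * int (l + j')))
          = q powi (- ((m - int s) * int j')) * q powi (- ((m - int s + m') * int l))"
        by (simp only: powi_add[symmetric])
      then show ?thesis by (simp only: mult.assoc[symmetric]) (simp only: mult_ac)
    qed
    show "dft (\<lambda>l. sc (q powi (- ((m - int s) * int (l + j'))) * ?b) (y (l, j - s + j'))) m'
      = sc (q powi (- ((m - int s) * int j')) * ?b) (hat y (m - int s + m') (j - s + j'))"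
      unfolding hat_def dft_def scale_sum_right scale_scale c ..
  qed
  finally show ?thesis .
qed

end

section \<open>The skew recursion\<close>

lemma triangle_Suc: "Suc k * (Suc k - 1) div 2 = k * (k - 1) div 2 + k"
proof -
  have "even (k * (k - 1))" by (cases k) auto
  then obtain h where h: "k * (k - 1) = 2 * h" by blast
  have "Suc k * (Suc k - 1) = k * (k - 1) + 2 * k" by (cases k) (auto simp: algebra_simps)
  with h show ?thesis by simp
qed

context taft_scalars
begin

text \<open>The relation \<open>X k \<cdot> a = w (k \<cdot> a) - (G k \<cdot> a) w\<close> for \<open>k = X\<^sup>j G\<^sup>m\<^sup>-\<^sup>j\<close>, with \<open>F m j\<close> the
  normalization of \<open>k \<cdot> a\<close> that makes the convolution below free of scalars.\<close>
definition skew_rec :: "'a \<Rightarrow> (int \<Rightarrow> nat \<Rightarrow> 'a) \<Rightarrow> bool" where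
  "skew_rec w F \<longleftrightarrow> (\<forall>m j. sc (qnum q (Suc j)) (F (m + 1) (Suc j))
     = sc (q ^ j) (w * F m j) - F (m + 1) j * w)"

lemma skew_recD:
  "skew_rec w F \<Longrightarrow> sc (qnum q (Suc j)) (F (m + 1) (Suc j)) = sc (q ^ j) (w * F m j) - F (m + 1) j * w"
  by (simp add: skew_rec_def)

text \<open>Level \<open>j + 1\<close> is determined by level \<open>j\<close> as long as the
  q-number of \<open>j + 1\<close> is invertible, that is, below level \<open>n\<close>.\<close>

lemma skew_rec_unique:
  assumes "skew_rec w F" "skew_rec w G" "\<And>m. F m 0 = G m 0" "j < n"
  shows "F m j = G m j"
  using assms(4)
proof (induction j arbitrary: m)
  case (Suc j)
  have "sc (qnum q (Suc j)) (F (m - 1 + 1) (Suc j)) = sc (qnum q (Suc j)) (G (m - 1 + 1) (Suc j))"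
    unfolding skew_recD[OF assms(1)] skew_recD[OF assms(2)] using Suc by simp
  then show ?case using qnum_nz[of "Suc j"] Suc.prems by simp
qed (simp add: assms(3))

text \<open>A twisted Leibniz rule: applying the recursion to each factor produces two mixed terms
  \<open>F w G\<close>, which cancel. The convolution is the one by which \<open>hat_mult\<close>
  expresses products in A and T.\<close>

lemma skew_rec_convolution:
  assumes F: "skew_rec w F" and G: "skew_rec w G"
  shows "skew_rec w (\<lambda>m j. \<Sum>s\<le>j. F m s * G (m - int s) (j - s))"
  unfolding skew_rec_def
proof (intro allI)
  fix m j
  \<comment> \<open>These terms come from splitting the q-number of \<open>j + 1\<close> by
    \<open>qnum_add\<close>: \<open>T1\<close> lets the recursion lower \<open>F\<close>, and
    \<open>T2\<close> lets it lower \<open>G\<close>. The mixed terms cancel between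
    \<open>T1 (Suc s)\<close> and \<open>T2 s\<close>, while \<open>T1 0\<close> and
    \<open>T2 (Suc j)\<close> are zero.\<close>
  define T1 T2 where "T1 s = sc (q ^ (Suc j - s) * qnum q s) (F (m + 1) s * G (m + 1 - int s) (Suc j - s))"
    and "T2 s = sc (qnum q (Suc j - s)) (F (m + 1) s * G (m + 1 - int s) (Suc j - s))" for s
  have split: "T1 (Suc s) + T2 s = sc (q ^ j) (w * (F m s * G (m - int s) (j - s)))
      - F (m + 1) s * G (m + 1 - int s) (j - s) * w" if "s \<le> j" for s
  proof -
    have "T1 (Suc s) = sc (q ^ (j - s)) (sc (qnum q (Suc s)) (F (m + 1) (Suc s)) * G (m - int s) (j - s))"
      by (simp add: T1_def sc_mult_left)
    then have 1: "T1 (Suc s) = sc (q ^ j) (w * (F m s * G (m - int s) (j - s)))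
        - sc (q ^ (j - s)) (F (m + 1) s * w * G (m - int s) (j - s))"
      using that by (simp add: skew_recD[OF F] left_diff_distrib sc_mult_left scale_right_diff_distrib
          mult.assoc flip: power_add)
    have "T2 s = F (m + 1) s * sc (qnum q (Suc (j - s))) (G (m - int s + 1) (Suc (j - s)))"
      using that by (simp add: T2_def sc_mult_right Suc_diff_le algebra_simps)
    then have "T2 s = sc (q ^ (j - s)) (F (m + 1) s * w * G (m - int s) (j - s))
        - F (m + 1) s * G (m + 1 - int s) (j - s) * w"
      unfolding skew_recD[OF G] by (simp add: right_diff_distrib sc_mult_right mult.assoc add_diff_eq add_ac)
    with 1 show ?thesis by simp
  qed
  have "sc (qnum q (Suc j)) (\<Sum>s\<le>Suc j. F (m + 1) s * G (m + 1 - int s) (Suc j - s))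
      = (\<Sum>s\<le>Suc j. T1 s + T2 s)"
    unfolding scale_sum_right
  proof (intro sum.cong refl)
    fix s assume "s \<in> {..Suc j}"
    then have "qnum q (Suc j) = q ^ (Suc j - s) * qnum q s + qnum q (Suc j - s)"
      using qnum_add[of q s "Suc j - s"] by simp
    then show "sc (qnum q (Suc j)) (F (m + 1) s * G (m + 1 - int s) (Suc j - s)) = T1 s + T2 s"
      by (simp only: T1_def T2_def scale_left_distrib)
  qed
  also have "\<dots> = (\<Sum>s\<le>Suc j. T1 s) + (\<Sum>s\<le>Suc j. T2 s)"
    by (rule sum.distrib)
  also have "(\<Sum>s\<le>Suc j. T1 s) = (\<Sum>s\<le>j. T1 (Suc s))"
    unfolding sum.atMost_Suc_shift by (simp add: T1_def)
  also have "(\<Sum>s\<le>Suc j. T2 s) = (\<Sum>s\<le>j. T2 s)"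
    by (simp add: T2_def)
  also have "(\<Sum>s\<le>j. T1 (Suc s)) + (\<Sum>s\<le>j. T2 s)
      = (\<Sum>s\<le>j. sc (q ^ j) (w * (F m s * G (m - int s) (j - s)))
          - F (m + 1) s * G (m + 1 - int s) (j - s) * w)"
    unfolding sum.distrib[symmetric] by (intro sum.cong refl split) simp
  also have "\<dots> = sc (q ^ j) (w * (\<Sum>s\<le>j. F m s * G (m - int s) (j - s)))
      - (\<Sum>s\<le>j. F (m + 1) s * G (m + 1 - int s) (j - s)) * w"
    by (simp add: sum_subtractf scale_sum_right sum_distrib_left sum_distrib_right)
  finally show "sc (qnum q (Suc j)) (\<Sum>s\<le>Suc j. F (m + 1) s * G (m + 1 - int s) (Suc j - s))
    = sc (q ^ j) (w * (\<Sum>s\<le>j. F m s * G (m - int s) (j - s)))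
      - (\<Sum>s\<le>j. F (m + 1) s * G (m + 1 - int s) (j - s)) * w" .
qed

text \<open>The scalar is the one in \<open>hat_coassoc\<close>. The q-binomial turns the q-number
  of \<open>t + 1\<close> into that of \<open>t + k + 1\<close> by \<open>qnum_times_qbinom\<close>,
  and the phase absorbs the remaining q^k.\<close>

lemma skew_rec_shift:
  assumes F: "skew_rec w F"
  shows "skew_rec w (\<lambda>m t. sc (q powi (- (m * int k)) * qbinom q (t + k) k) (F (m + m') (t + k)))"
  unfolding skew_rec_def
proof (intro allI)
  fix m t
  let ?a = "q powi (- ((m + 1) * int k))" and ?b = "qbinom q (t + k) k"
  have a: "?a * q ^ (t + k) = q ^ t * q powi (- (m * int k))"
    by (simp add: algebra_simps power_add flip: power_int_of_nat powi_add)
  have "sc (qnum q (Suc t)) (sc (?a * qbinom q (Suc t + k) k) (F (m + 1 + m') (Suc t + k)))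
      = sc (?a * (qnum q (Suc t) * qbinom q (Suc t + k) k)) (F (m + m' + 1) (Suc (t + k)))"
    by (simp add: ac_simps)
  also have "\<dots> = sc (?a * ?b) (sc (qnum q (Suc (t + k))) (F (m + m' + 1) (Suc (t + k))))"
    by (simp only: qnum_times_qbinom[OF q_neq_1]) (simp add: ac_simps)
  also have "\<dots> = sc (?a * q ^ (t + k) * ?b) (w * F (m + m') (t + k))
      - sc (?a * ?b) (F (m + m' + 1) (t + k) * w)"
    unfolding skew_recD[OF F] by (simp add: scale_right_diff_distrib ac_simps)
  finally show "sc (qnum q (Suc t)) (sc (?a * qbinom q (Suc t + k) k) (F (m + 1 + m') (Suc t + k)))
    = sc (q ^ t) (w * sc (q powi (- (m * int k)) * ?b) (F (m + m') (t + k)))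
      - sc (?a * ?b) (F (m + 1 + m') (t + k)) * w"
    unfolding a by (simp add: sc_mult_left sc_mult_right ac_simps)
qed

section \<open>Closed form of the solution of the skew recursion\<close>

definition skew_coeff :: "nat \<Rightarrow> nat \<Rightarrow> 'k" where
  "skew_coeff j k = (-1) ^ k * q powi (- int (k * (k - 1) div 2)) * qbinom (inverse q) j k"

text \<open>The inner sum over \<open>k\<close> in (i). With \<open>f m\<close> the action of G^m on
  \<open>a\<close>, it is the expected value of X^j G^i on \<open>a\<close>: a j-fold twisted
  commutator with \<open>w\<close>.\<close>

definition skew_form :: "'a \<Rightarrow> (int \<Rightarrow> 'a) \<Rightarrow> int \<Rightarrow> nat \<Rightarrow> 'a" where
  "skew_form w f i j = (\<Sum>k\<le>j. sc (skew_coeff j k) (w ^ (j - k) * f (i + int k) * w ^ k))"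

lemma skew_coeff_0 [simp]: "skew_coeff j 0 = 1"
  by (simp add: skew_coeff_def)

lemma skew_coeff_eq_0: "j < k \<Longrightarrow> skew_coeff j k = 0"
  by (simp add: skew_coeff_def qbinom_eq_0)

lemma skew_coeff_Suc_Suc:
  assumes "k \<le> j"
  shows "skew_coeff (Suc j) (Suc k) = skew_coeff j (Suc k) - q powi (- int j) * skew_coeff j k"
proof -
  let ?t = "\<lambda>k. - int (k * (k - 1) div 2)"
  have "q powi ?t (Suc k) * inverse q ^ (j - k) = q powi (?t k - int k) * q powi (- int (j - k))"
    unfolding triangle_Suc by (simp add: power_int_minus power_inverse)
  also have "\<dots> = q powi (- int j) * q powi ?t k"
    using assms by (simp flip: powi_add add: of_nat_diff algebra_simps)
  finally have e: "q powi ?t (Suc k) * inverse q ^ (j - k) = q powi (- int j) * q powi ?t k" .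
  have "skew_coeff (Suc j) (Suc k) = skew_coeff j (Suc k)
      + (-1) ^ Suc k * (q powi ?t (Suc k) * inverse q ^ (j - k)) * qbinom (inverse q) j k"
    unfolding skew_coeff_def qbinom_Suc_Suc'[OF assms] by (simp only: distrib_left ac_simps)
  then show ?thesis
    unfolding e by (simp add: skew_coeff_def ac_simps)
qed

lemma skew_form_0 [simp]: "skew_form w f i 0 = f i"
  by (simp add: skew_form_def)

text \<open>By the second q-Pascal rule each coefficient at level \<open>j + 1\<close> is a
  difference of two at level \<open>j\<close>. One part has a common left factor \<open>w\<close>,
  the other a common right factor \<open>w\<close>.\<close>

lemma skew_form_Suc:
  "skew_form w f i (Suc j)
    = w * skew_form w f i j - sc (q powi (- int j)) (skew_form w f (i + 1) j * w)"
proof -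
  define X where "X k = w ^ (Suc j - k) * f (i + int k) * w ^ k" for k
  have "skew_form w f i (Suc j)
      = X 0 + (\<Sum>k\<le>j. sc (skew_coeff j (Suc k) - q powi (- int j) * skew_coeff j k) (X (Suc k)))"
    unfolding skew_form_def sum.atMost_Suc_shift
    by (simp add: X_def skew_coeff_Suc_Suc)
  also have "\<dots> = (X 0 + (\<Sum>k\<le>j. sc (skew_coeff j (Suc k)) (X (Suc k))))
      - (\<Sum>k\<le>j. sc (q powi (- int j) * skew_coeff j k) (X (Suc k)))"
    by (simp add: scale_left_diff_distrib sum_subtractf)
  also have "X 0 + (\<Sum>k\<le>j. sc (skew_coeff j (Suc k)) (X (Suc k))) = (\<Sum>k\<le>Suc j. sc (skew_coeff j k) (X k))"
    unfolding sum.atMost_Suc_shift by simp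
  also have "\<dots> = (\<Sum>k\<le>j. sc (skew_coeff j k) (X k))"
    by (simp add: skew_coeff_eq_0)
  also have "\<dots> = w * skew_form w f i j"
    unfolding skew_form_def sum_distrib_left X_def
    by (intro sum.cong refl) (simp add: sc_mult_right Suc_diff_le mult.assoc)
  also have "(\<Sum>k\<le>j. sc (q powi (- int j) * skew_coeff j k) (X (Suc k)))
      = sc (q powi (- int j)) (skew_form w f (i + 1) j * w)"
    unfolding skew_form_def sum_distrib_right scale_sum_right X_def
    by (intro sum.cong refl) (simp add: sc_mult_left power_commutes mult.assoc ac_simps flip: power_Suc2)
  finally show ?thesis .
qed

text \<open>At level \<open>n\<close> the inner q-binomials vanish by \<open>qbinom_n\<close>,
  leaving the two ends. For periodic \<open>f\<close> this is the commutator of w^n with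
  \<open>f i\<close>, which links the relation X^n = 0 to condition (ii).\<close>

lemma skew_form_n: "skew_form w f i n = w ^ n * f i - f (i + int n) * w ^ n"
proof -
  have "skew_form w f i n = (\<Sum>k\<in>{0, n}. sc (skew_coeff n k) (w ^ (n - k) * f (i + int k) * w ^ k))"
    unfolding skew_form_def
    by (intro sum.mono_neutral_right) (auto simp: skew_coeff_def qbinom_n)
  also have "skew_coeff n n = -1"
    using powi_triangle by (simp add: skew_coeff_def)
  then have "(\<Sum>k\<in>{0, n}. sc (skew_coeff n k) (w ^ (n - k) * f (i + int k) * w ^ k))
      = w ^ n * f i - f (i + int n) * w ^ n"
    by simp
  finally show ?thesis .
qed

text \<open>The inverse, below level \<open>n\<close>, of the normalization q^(j(j-1)/2) / (j)_q!
  relating X^j G^(m-j) to a solution of \<open>skew_rec\<close>.\<close>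

definition skew_scale :: "nat \<Rightarrow> 'k" where
  "skew_scale j = qfact q j * q powi (- int (j * (j - 1) div 2))"

lemma skew_scale_0 [simp]: "skew_scale 0 = 1"
  by (simp add: skew_scale_def)

lemma skew_scale_Suc: "skew_scale (Suc j) = q powi (- int j) * skew_scale j * qnum q (Suc j)"
proof -
  have "q powi (- int (Suc j * (Suc j - 1) div 2)) = q powi (- int (j * (j - 1) div 2)) * q powi (- int j)"
    unfolding triangle_Suc powi_add[symmetric] by simp
  then show ?thesis by (simp only: skew_scale_def qfact.simps ac_simps)
qed

lemma skew_scale_nz: "j < n \<Longrightarrow> skew_scale j \<noteq> 0"
  by (simp add: skew_scale_def qfact_nz)

text \<open>Nothing is divided by a q-number, so the identity holds at every level. Level
  \<open>n\<close> is the one that yields the centrality of w^n.\<close>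

lemma skew_form_eq_of_rec:
  assumes "skew_rec w F"
  shows "skew_form w (\<lambda>m. F m 0) i j = sc (skew_scale j) (F (i + int j) j)"
proof (induction j arbitrary: i)
  case (Suc j)
  let ?c = "q powi (- int j)"
  have c: "?c * q ^ j = 1" by (simp add: power_int_minus)
  have "skew_form w (\<lambda>m. F m 0) i (Suc j)
      = sc (skew_scale j) (w * F (i + int j) j)
        - sc (?c * skew_scale j) (F (i + 1 + int j) j * w)"
    by (simp add: skew_form_Suc Suc.IH sc_mult_left sc_mult_right)
  also have "\<dots> = sc (?c * skew_scale j) (sc (q ^ j) (w * F (i + int j) j) - F (i + int j + 1) j * w)"
  proof -
    have "?c * skew_scale j * q ^ j = skew_scale j"
      using c by (metis mult.assoc mult.commute mult_1)
    then show ?thesis by (simp add: scale_right_diff_distrib add_ac)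
  qed
  also have "\<dots> = sc (skew_scale (Suc j)) (F (i + int j + 1) (Suc j))"
    unfolding skew_recD[OF assms, symmetric] by (simp add: skew_scale_Suc)
  finally show ?case by (simp add: add_ac)
qed simp

text \<open>Below level \<open>n\<close> the recursions for \<open>skew_form\<close> and
  \<open>F\<close> agree up to an invertible scalar. At the boundary \<open>Suc j = n\<close>,
  periodicity and centrality make \<open>skew_form\<close> vanish, in accordance with
  \<open>zero\<close>.\<close>

lemma rec_of_skew_form_eq:
  assumes eq: "\<And>i j. j < n \<Longrightarrow> skew_form w f i j = sc (skew_scale j) (F (i + int j) j)"
    and zero: "\<And>m j. n \<le> j \<Longrightarrow> F m j = 0"
    and period: "\<And>i. f (i + int n) = f i"
    and central: "\<And>i. w ^ n * f i = f i * w ^ n"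
  shows "skew_rec w F"
  unfolding skew_rec_def
proof (intro allI)
  fix m j
  show "sc (qnum q (Suc j)) (F (m + 1) (Suc j)) = sc (q ^ j) (w * F m j) - F (m + 1) j * w"
  proof (cases "j < n")
    case True
    let ?c = "q powi (- int j)"
    have c: "?c * q ^ j = 1" by (simp add: power_int_minus)
    define i where "i = m - int j"
    have "sc (skew_scale (Suc j)) (F (m + 1) (Suc j)) = skew_form w f i (Suc j)"
    proof (cases "Suc j < n")
      case True
      then show ?thesis by (simp add: eq i_def)
    next
      case False
      with \<open>j < n\<close> have "Suc j = n" by simp
      moreover have "skew_form w f i n = 0"
        by (simp add: skew_form_n period central)
      ultimately show ?thesis by (simp add: zero)
    qed
    also have "\<dots> = sc (skew_scale j) (w * F m j) - sc (?c * skew_scale j) (F (m + 1) j * w)"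
      using True by (simp add: skew_form_Suc eq sc_mult_left sc_mult_right i_def)
    also have "\<dots> = sc (?c * skew_scale j) (sc (q ^ j) (w * F m j) - F (m + 1) j * w)"
    proof -
      have "?c * skew_scale j * q ^ j = skew_scale j"
        using c by (metis mult.assoc mult.commute mult_1)
      then show ?thesis by (simp add: scale_right_diff_distrib)
    qed
    \<comment> \<open>Only \<open>?c * skew_scale j\<close> is cancelled; the q-number of
      \<open>Suc j\<close> stays, since it is zero when \<open>Suc j = n\<close>.\<close>
    finally have "sc (?c * skew_scale j) (sc (qnum q (Suc j)) (F (m + 1) (Suc j)))
      = sc (?c * skew_scale j) (sc (q ^ j) (w * F m j) - F (m + 1) j * w)"
      by (simp add: skew_scale_Suc)
    then show ?thesis
      using skew_scale_nz[OF True] by (subst (asm) scale_cancel_left) auto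
  qed (simp add: zero)
qed

end

section \<open>Partial coactions in terms of the dual\<close>

lemma sum_fun_apply: "(\<Sum>x\<in>S. f x) y = (\<Sum>x\<in>S. f x y)"
  by (induction S rule: infinite_finite_induct) simp_all

context taft_scalars
begin

text \<open>The other half of Fourier inversion: any prescribed values on a window of
  \<open>n\<close> frequencies are attained. It recovers the summands of (i) from the
  coordinates.\<close>

lemma dft_inverse':
  assumes "k < n"
  shows "dft (\<lambda>l. sc (inverse (of_nat n)) (\<Sum>i<n. sc (q powi ((int i + c) * int l)) (X i))) (int k + c) = X k"
proof -
  have "dft (\<lambda>l. sc (inverse (of_nat n)) (\<Sum>i<n. sc (q powi ((int i + c) * int l)) (X i))) (int k + c)
      = sc (inverse (of_nat n)) (\<Sum>l<n. \<Sum>i<n. sc (q powi (int l * (int i - int k))) (X i))"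
    unfolding dft_def scale_sum_right scale_scale
  proof (intro sum.cong refl arg_cong2[where f = sc])
    fix l i
    have "- ((int k + c) * int l) + (int i + c) * int l = int l * (int i - int k)"
      by (simp add: algebra_simps)
    then show "q powi (- ((int k + c) * int l)) * (inverse (of_nat n) * q powi ((int i + c) * int l))
        = inverse (of_nat n) * q powi (int l * (int i - int k))"
      by (simp add: powi_add mult.left_commute flip: powi_add)
  qed
  also have "(\<Sum>l<n. \<Sum>i<n. sc (q powi (int l * (int i - int k))) (X i))
      = (\<Sum>i<n. sc (\<Sum>l<n. q powi (int l * (int i - int k))) (X i))"
    by (subst sum.swap) (simp add: scale_sum_left)
  also have "\<dots> = (\<Sum>i<n. if i = k then sc (of_nat n) (X i) else 0)"
    using assms by (intro sum.cong refl) (simp add: sum_powi)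
  also have "\<dots> = sc (of_nat n) (X k)"
    using assms by simp
  finally show ?thesis by (simp add: of_nat_n_nz)
qed

lemma hat_eq_iff:
  "(\<forall>b\<in>taft_basis n. u b = v b) \<longleftrightarrow> (\<forall>j<n. \<forall>m. hat u m j = hat v m j)"
  by (simp add: hat_def dft_eq_iff taft_basis_def) blast

end

text \<open>Vanishing off the basis makes the coefficient function of an element of the tensor
  product unique, so (i) can be an equality of functions.\<close>

locale taft_map = taft_scalars n q sc
  for n :: nat and q :: "'k::field" and sc :: "'k \<Rightarrow> 'a::{ring,monoid_mult} \<Rightarrow> 'a" +
  fixes \<rho> :: "'a \<Rightarrow> nat \<times> nat \<Rightarrow> 'a"
  assumes supp: "b \<notin> taft_basis n \<Longrightarrow> \<rho> a b = 0"
    and map_add: "\<rho> (a + c) = \<rho> a + \<rho> c"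
    and map_scale: "\<rho> (sc r a) = (\<lambda>b. sc r (\<rho> a b))"
begin

text \<open>In Hopf terms \<open>E m j\<close> is the action on \<open>A\<close> of the element
  \<open>q\<^sup>j\<^sup>(\<^sup>j\<^sup>-\<^sup>1\<^sup>)\<^sup>/\<^sup>2 / (j)\<^sub>q! X\<^sup>j G\<^sup>m\<^sup>-\<^sup>j\<close> of the dual Hopf algebra, where \<open>G\<close> is the character
  \<open>g \<mapsto> q\<^sup>-\<^sup>1, x \<mapsto> 0\<close> and \<open>X\<close> the skew-primitive functional with \<open>w = X \<cdot> 1\<close>.\<close>
definition E :: "int \<Rightarrow> nat \<Rightarrow> 'a \<Rightarrow> 'a" where
  "E m j a = hat (\<rho> a) m j"

lemma E_add: "E m j (a + c) = E m j a + E m j c"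
  by (simp add: E_def hat_def dft_def map_add scale_right_distrib sum.distrib)

lemma E_scale: "E m j (sc r a) = sc r (E m j a)"
  by (simp add: E_def hat_def dft_def map_scale scale_sum_right mult.commute)

lemma E_zero [simp]: "E m j 0 = 0"
  using E_scale[of m j 0 0] by simp

lemma E_minus: "E m j (- a) = - E m j a"
  using E_add[of m j a "- a"] by (simp add: eq_neg_iff_add_eq_0 add.commute)

lemma E_diff: "E m j (a - c) = E m j a - E m j c"
  using E_add[of m j a "- c"] by (simp add: E_minus)

lemma E_sum: "E m j (\<Sum>s\<in>S. f s) = (\<Sum>s\<in>S. E m j (f s))"
  by (induction S rule: infinite_finite_induct) (simp_all add: E_add)

lemma E_eq_0: "n \<le> j \<Longrightarrow> E m j a = 0"
  by (simp add: E_def hat_def dft_def supp taft_basis_def)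

lemma E_cong_mod: "m mod int n = m' mod int n \<Longrightarrow> E m j a = E m' j a"
  unfolding E_def hat_def by (rule dft_cong_mod)

lemma E_E: "E m j (E m' j' a) = dft (\<lambda>l. hat (\<rho> (\<rho> a (l, j'))) m j) m'"
proof -
  have "E m j (E m' j' a) = (\<Sum>l<n. sc (q powi (- (m' * int l))) (E m j (\<rho> a (l, j'))))"
    unfolding E_def[of m' j' a] hat_def dft_def E_sum E_scale ..
  then show ?thesis by (simp add: E_def dft_def)
qed

text \<open>The three axioms of a partial coaction after a Fourier transform in every tensor leg,
  that is, as laws for the action of the dual Hopf algebra.\<close>

definition coact :: bool where
  "coact \<longleftrightarrow> (\<forall>a. E 0 0 a = a) \<and>
    (\<forall>a c m j. j < n \<longrightarrow> E m j (a * c) = (\<Sum>s\<le>j. E m s a * E (m - int s) (j - s) c)) \<and>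
    (\<forall>a m m' j j'. j < n \<longrightarrow> j' < n \<longrightarrow> E m j (E m' j' a)
      = (\<Sum>s\<le>j. E m s 1 * sc (q powi (- ((m - int s) * int j')) * qbinom q (j - s + j') j')
          (E (m - int s + m') (j - s + j') a)))"

lemma counit_iff: "(\<Sum>b\<in>taft_basis n. sc (taft_eps b) (\<rho> a b)) = E 0 0 a"
proof -
  have "(\<Sum>j<n. sc (taft_eps (l, j)) (\<rho> a (l, j))) = (\<Sum>j<n. if j = 0 then \<rho> a (l, j) else 0)" for l
    by (intro sum.cong) (auto simp: taft_eps_def)
  then show ?thesis
    unfolding sum_taft_basis by (simp add: E_def hat_def dft_def)
qed

lemma mult_iff:
  "(\<forall>b\<in>taft_basis n. \<rho> (a * c) b
      = (\<Sum>b1\<in>taft_basis n. \<Sum>b2\<in>taft_basis n. sc (taft_mu n q b1 b2 b) (\<rho> a b1 * \<rho> c b2)))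
    \<longleftrightarrow> (\<forall>m j. j < n \<longrightarrow> E m j (a * c) = (\<Sum>s\<le>j. E m s a * E (m - int s) (j - s) c))"
  unfolding hat_eq_iff E_def by (auto simp: hat_mult)

lemma coassoc_iff:
  "(\<forall>b1\<in>taft_basis n. \<forall>b2\<in>taft_basis n. \<rho> (\<rho> a b2) b1 =
      (\<Sum>c1\<in>taft_basis n. \<Sum>c2\<in>taft_basis n. \<Sum>d1\<in>taft_basis n. \<Sum>d2\<in>taft_basis n.
        \<Sum>e\<in>taft_basis n.
          sc (taft_one c2 * taft_delta n q e d1 d2 * taft_mu n q c1 d1 b1 * taft_mu n q c2 d2 b2)
            (\<rho> 1 c1 * \<rho> a e)))
    \<longleftrightarrow> (\<forall>m m' j j'. j < n \<longrightarrow> j' < n \<longrightarrow> E m j (E m' j' a)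
      = (\<Sum>s\<le>j. E m s 1 * sc (q powi (- ((m - int s) * int j')) * qbinom q (j - s + j') j')
          (E (m - int s + m') (j - s + j') a)))"
proof -
  define R where "R b2 b1 = (\<Sum>c1\<in>taft_basis n. \<Sum>c2\<in>taft_basis n. \<Sum>d1\<in>taft_basis n.
      \<Sum>d2\<in>taft_basis n. \<Sum>e\<in>taft_basis n.
        sc (taft_one c2 * taft_delta n q e d1 d2 * taft_mu n q c1 d1 b1 * taft_mu n q c2 d2 b2)
          (\<rho> 1 c1 * \<rho> a e))" for b1 b2
  have R: "dft (\<lambda>l. hat (R (l, j')) m j) m'
      = (\<Sum>s\<le>j. E m s 1 * sc (q powi (- ((m - int s) * int j')) * qbinom q (j - s + j') j')
          (E (m - int s + m') (j - s + j') a))" if "j < n" "j' < n" for m m' j j'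
    unfolding R_def E_def by (rule hat_coassoc[OF supp that])
  have "(\<forall>b1\<in>taft_basis n. \<forall>b2\<in>taft_basis n. \<rho> (\<rho> a b2) b1 = R b2 b1)
      \<longleftrightarrow> (\<forall>b2\<in>taft_basis n. \<forall>b1\<in>taft_basis n. \<rho> (\<rho> a b2) b1 = R b2 b1)"
    by blast
  also have "\<dots> \<longleftrightarrow> (\<forall>b2\<in>taft_basis n. \<forall>j<n. \<forall>m. hat (\<rho> (\<rho> a b2)) m j = hat (R b2) m j)"
    by (simp only: hat_eq_iff)
  also have "\<dots> \<longleftrightarrow> (\<forall>j<n. \<forall>j'<n. \<forall>m. \<forall>l<n. hat (\<rho> (\<rho> a (l, j'))) m j = hat (R (l, j')) m j)"
    by (auto simp: taft_basis_def)
  also have "\<dots> \<longleftrightarrow> (\<forall>j<n. \<forall>j'<n. \<forall>m. \<forall>m'.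
      dft (\<lambda>l. hat (\<rho> (\<rho> a (l, j'))) m j) m' = dft (\<lambda>l. hat (R (l, j')) m j) m')"
    by (simp only: dft_eq_iff)
  also have "\<dots> \<longleftrightarrow> (\<forall>m m' j j'. j < n \<longrightarrow> j' < n \<longrightarrow> E m j (E m' j' a)
      = (\<Sum>s\<le>j. E m s 1 * sc (q powi (- ((m - int s) * int j')) * qbinom q (j - s + j') j')
          (E (m - int s + m') (j - s + j') a)))"
    by (auto simp: R simp flip: E_E)
  finally show ?thesis by (simp only: R_def)
qed

lemma partial_coaction_taft_iff:
  "partial_coaction sc (taft_basis n) (taft_mu n q) (taft_delta n q) taft_eps taft_one \<rho> \<longleftrightarrow> coact"
  unfolding partial_coaction_def counit_iff mult_iff coassoc_iff coact_def by blast

section \<open>The same translation for the group algebra of the cyclic group\<close>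

definition cyc_coact :: bool where
  "cyc_coact \<longleftrightarrow> (\<forall>a. E 0 0 a = a) \<and> (\<forall>a c m. E m 0 (a * c) = E m 0 a * E m 0 c) \<and>
    (\<forall>a m m'. E m 0 (E m' 0 a) = E m 0 1 * E (m + m') 0 a)"

lemma cyc_mult_iff:
  "(\<forall>b\<in>{..<n}. \<rho> (a * c) (b, 0)
      = (\<Sum>b1\<in>{..<n}. \<Sum>b2\<in>{..<n}. sc (cyc_mu n b1 b2 b) (\<rho> a (b1, 0) * \<rho> c (b2, 0))))
    \<longleftrightarrow> (\<forall>m. E m 0 (a * c) = E m 0 a * E m 0 c)"
proof -
  have "(\<Sum>b1<n. \<Sum>b2<n. sc (cyc_mu n b1 b2 b) (\<rho> a (b1, 0) * \<rho> c (b2, 0)))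
    = (\<Sum>l1<n. \<Sum>l2<n. if (l1 + l2) mod n = b
        then sc (q ^ (0 * l2)) (\<rho> a (l1, 0) * \<rho> c (l2, 0)) else 0)" for b
    by (intro sum.cong refl) (simp add: cyc_mu_def)
  then show ?thesis
    using dft_mult[of 0 "\<lambda>l. \<rho> a (l, 0)" "\<lambda>l. \<rho> c (l, 0)"]
    by (simp add: E_def hat_def Ball_def flip: dft_eq_iff)
qed

text \<open>The vacuous factor \<open>q ^ (0 * l2)\<close> puts the sum into the shape of
  \<open>dft_mult\<close> with twist 0.\<close>

lemma cyc_coassoc_coordinate:
  assumes "b2 < n"
  shows "(\<Sum>c1\<in>{..<n}. \<Sum>c2\<in>{..<n}. \<Sum>d1\<in>{..<n}. \<Sum>d2\<in>{..<n}. \<Sum>e\<in>{..<n}.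
      sc (cyc_one c2 * cyc_delta e d1 d2 * cyc_mu n c1 d1 b1 * cyc_mu n c2 d2 b2) (x c1 * y e))
    = (\<Sum>l1<n. \<Sum>l2<n. if (l1 + l2) mod n = b1
        then sc (q ^ (0 * l2)) (x l1 * (if l2 = b2 then y b2 else 0)) else 0)"
proof (rule sum.cong[OF refl])
  fix c1
  define F where "F c2 d = sc (cyc_mu n c1 d b1 * cyc_mu n c2 d b2) (x c1 * y d)" for c2 d
  have "(\<Sum>c2\<in>{..<n}. \<Sum>d1\<in>{..<n}. \<Sum>d2\<in>{..<n}. \<Sum>e\<in>{..<n}.
      sc (cyc_one c2 * cyc_delta e d1 d2 * cyc_mu n c1 d1 b1 * cyc_mu n c2 d2 b2) (x c1 * y e))
    = (\<Sum>c2<n. if c2 = 0 then \<Sum>d1<n. \<Sum>d2<n. \<Sum>e<n.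
        sc (cyc_delta e d1 d2 * cyc_mu n c1 d1 b1 * cyc_mu n 0 d2 b2) (x c1 * y e) else 0)"
    by (intro sum.cong refl) (simp add: cyc_one_def)
  also have "\<dots> = (\<Sum>d1<n. \<Sum>d2<n. \<Sum>e<n.
        sc (cyc_delta e d1 d2 * cyc_mu n c1 d1 b1 * cyc_mu n 0 d2 b2) (x c1 * y e))"
    by simp
  also have "\<dots> = (\<Sum>d1<n. \<Sum>d2<n. \<Sum>e<n. if e = d1 then if d2 = d1 then F 0 d1 else 0 else 0)"
    by (intro sum.cong refl) (simp add: cyc_delta_def F_def)
  also have "\<dots> = (\<Sum>d<n. F 0 d)" by simp
  also have "\<dots> = (\<Sum>l2<n. if (c1 + l2) mod n = b1
        then sc (q ^ (0 * l2)) (x c1 * (if l2 = b2 then y b2 else 0)) else 0)"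
    by (intro sum.cong refl) (auto simp: F_def cyc_mu_def)
  finally show "(\<Sum>c2\<in>{..<n}. \<Sum>d1\<in>{..<n}. \<Sum>d2\<in>{..<n}. \<Sum>e\<in>{..<n}.
      sc (cyc_one c2 * cyc_delta e d1 d2 * cyc_mu n c1 d1 b1 * cyc_mu n c2 d2 b2) (x c1 * y e))
    = (\<Sum>l2<n. if (c1 + l2) mod n = b1
        then sc (q ^ (0 * l2)) (x c1 * (if l2 = b2 then y b2 else 0)) else 0)" .
qed

lemma cyc_coassoc_iff:
  "(\<forall>b1\<in>{..<n}. \<forall>b2\<in>{..<n}. \<rho> (\<rho> a (b2, 0)) (b1, 0) =
      (\<Sum>c1\<in>{..<n}. \<Sum>c2\<in>{..<n}. \<Sum>d1\<in>{..<n}. \<Sum>d2\<in>{..<n}. \<Sum>e\<in>{..<n}.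
        sc (cyc_one c2 * cyc_delta e d1 d2 * cyc_mu n c1 d1 b1 * cyc_mu n c2 d2 b2)
          (\<rho> 1 (c1, 0) * \<rho> a (e, 0))))
    \<longleftrightarrow> (\<forall>m m'. E m 0 (E m' 0 a) = E m 0 1 * E (m + m') 0 a)"
proof -
  define R where "R b2 b1 = (\<Sum>c1\<in>{..<n}. \<Sum>c2\<in>{..<n}. \<Sum>d1\<in>{..<n}. \<Sum>d2\<in>{..<n}. \<Sum>e\<in>{..<n}.
        sc (cyc_one c2 * cyc_delta e d1 d2 * cyc_mu n c1 d1 b1 * cyc_mu n c2 d2 b2)
          (\<rho> 1 (c1, 0) * \<rho> a (e, 0)))" for b1 b2
  have R: "dft (R b2) m = E m 0 1 * sc (q powi (- (m * int b2))) (\<rho> a (b2, 0))" if "b2 < n" for b2 m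
  proof -
    have "dft (R b2) m = E m 0 1 * dft (\<lambda>l. if l = b2 then \<rho> a (b2, 0) else 0) m"
      using that dft_mult[of 0 "\<lambda>l. \<rho> 1 (l, 0)" "\<lambda>l. if l = b2 then \<rho> a (b2, 0) else 0" m]
      unfolding R_def by (simp only: cyc_coassoc_coordinate E_def hat_def) simp
    also have "dft (\<lambda>l. if l = b2 then \<rho> a (b2, 0) else 0) m = sc (q powi (- (m * int b2))) (\<rho> a (b2, 0))"
      using that by (simp add: dft_def if_distrib[of "sc _"] cong: if_cong)
    finally show ?thesis .
  qed
  have RR: "dft (\<lambda>b2. dft (R b2) m) m' = E m 0 1 * E (m + m') 0 a" for m m'
  proof -
    have "dft (\<lambda>b2. dft (R b2) m) m'
        = dft (\<lambda>b2. E m 0 1 * sc (q powi (- (m * int b2))) (\<rho> a (b2, 0))) m'"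
      by (rule dft_cong) (rule R)
    also have "\<dots> = E m 0 1 * dft (\<lambda>b2. sc (q powi (- (m * int b2))) (\<rho> a (b2, 0))) m'"
      by (rule dft_times_left)
    also have "dft (\<lambda>b2. sc (q powi (- (m * int b2))) (\<rho> a (b2, 0))) m' = E (m + m') 0 a"
      by (simp add: E_def hat_def dft_def algebra_simps flip: powi_add)
    finally show ?thesis .
  qed
  have "(\<forall>b1\<in>{..<n}. \<forall>b2\<in>{..<n}. \<rho> (\<rho> a (b2, 0)) (b1, 0) = R b2 b1)
      \<longleftrightarrow> (\<forall>b2<n. \<forall>b1<n. \<rho> (\<rho> a (b2, 0)) (b1, 0) = R b2 b1)"
    by auto
  also have "\<dots> \<longleftrightarrow> (\<forall>b2<n. \<forall>m. dft (\<lambda>b1. \<rho> (\<rho> a (b2, 0)) (b1, 0)) m = dft (R b2) m)"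
    by (simp only: dft_eq_iff)
  also have "\<dots> \<longleftrightarrow> (\<forall>m. \<forall>b2<n. hat (\<rho> (\<rho> a (b2, 0))) m 0 = dft (R b2) m)"
    unfolding hat_def by blast
  also have "\<dots> \<longleftrightarrow> (\<forall>m m'. dft (\<lambda>l. hat (\<rho> (\<rho> a (l, 0))) m 0) m' = dft (\<lambda>b2. dft (R b2) m) m')"
    by (simp only: dft_eq_iff)
  also have "\<dots> \<longleftrightarrow> (\<forall>m m'. E m 0 (E m' 0 a) = E m 0 1 * E (m + m') 0 a)"
    by (simp only: RR E_E)
  finally show ?thesis by (simp only: R_def)
qed

lemma partial_coaction_cyc_iff:
  "partial_coaction sc {..<n} (cyc_mu n) cyc_delta cyc_eps cyc_one (proj_pi \<rho>) \<longleftrightarrow> cyc_coact"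
proof -
  have "(\<Sum>b\<in>{..<n}. sc (cyc_eps b) (\<rho> a (b, 0))) = E 0 0 a" for a
    by (simp add: cyc_eps_def E_def hat_def dft_def)
  then show ?thesis
    unfolding partial_coaction_def proj_pi_def cyc_mult_iff cyc_coassoc_iff cyc_coact_def
    by (simp only:)
qed

end

section \<open>Classification\<close>

context taft_map
begin

lemma coact_counit: "coact \<Longrightarrow> E 0 0 a = a"
  by (simp add: coact_def)

lemma coact_mult: "coact \<Longrightarrow> j < n \<Longrightarrow> E m j (a * c) = (\<Sum>s\<le>j. E m s a * E (m - int s) (j - s) c)"
  by (simp add: coact_def)

lemma coact_coassoc: "coact \<Longrightarrow> j < n \<Longrightarrow> j' < n \<Longrightarrow> E m j (E m' j' a)
    = (\<Sum>s\<le>j. E m s 1 * sc (q powi (- ((m - int s) * int j')) * qbinom q (j - s + j') j')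
        (E (m - int s + m') (j - s + j') a))"
  by (simp add: coact_def)

lemma coact_coassoc_0:
  "coact \<Longrightarrow> j' < n \<Longrightarrow> E m 0 (E m' j' a) = sc (q powi (- (m * int j'))) (E m 0 1 * E (m + m') j' a)"
  by (simp add: coact_coassoc sc_mult_right)

text \<open>The partial action law for X G^(m-1). The q-number appears as the q-binomial of
  \<open>j' + 1\<close> over \<open>j'\<close>.\<close>

lemma coact_coassoc_1:
  assumes "coact" "j' < n"
  shows "E m 1 (E m' j' a) = sc (q powi (- (m * int j')) * qnum q (Suc j')) (E m 0 1 * E (m + m') (Suc j') a)
    + sc (q powi (- ((m - 1) * int j'))) (E m 1 1 * E (m - 1 + m') j' a)"
proof -
  have "qbinom q (Suc j') j' = qnum q (Suc j')"
    using qnum_times_qbinom[OF q_neq_1, of 0 j'] by (simp add: qnum_Suc del: qbinom.simps)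
  then show ?thesis
    using assms n2 by (simp add: coact_coassoc sc_mult_right del: qbinom.simps)
qed

lemma coact_imp_cyc_coact: "coact \<Longrightarrow> cyc_coact"
  by (simp add: cyc_coact_def coact_counit coact_mult coact_coassoc_0)

lemma cyc_mult: "cyc_coact \<Longrightarrow> E m 0 (a * c) = E m 0 a * E m 0 c"
  by (simp add: cyc_coact_def)

lemma cyc_coassoc: "cyc_coact \<Longrightarrow> E m 0 (E m' 0 a) = E m 0 1 * E (m + m') 0 a"
  by (simp add: cyc_coact_def)

lemma cyc_counit: "cyc_coact \<Longrightarrow> E 0 0 a = a"
  by (simp add: cyc_coact_def)

text \<open>Compute \<open>G\<^sup>m \<cdot> (G\<^sup>-\<^sup>m \<cdot> b)\<close> directly and through \<open>b = b * 1\<close>.\<close>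
lemma cyc_absorb:
  assumes "cyc_coact"
  shows "E m 0 1 * b * E m 0 1 = E m 0 1 * b"
proof -
  have *: "E m 0 (E (- m) 0 a) = E m 0 1 * a" for a
    using assms by (simp add: cyc_coassoc cyc_counit)
  have "E m 0 1 * b = E m 0 (E (- m) 0 (b * 1))" by (simp add: *)
  also have "\<dots> = E m 0 (E (- m) 0 b) * E m 0 (E (- m) 0 1)"
    using assms by (simp only: cyc_mult)
  also have "\<dots> = E m 0 1 * b * E m 0 1" by (simp add: *)
  finally show ?thesis ..
qed

text \<open>Upward steps from \<open>m0\<close> reach every residue class, so no downward step is
  required.\<close>

lemma periodic_induct:
  assumes "P m0" and step: "\<And>m. P m \<Longrightarrow> P (m + 1)"
    and mod: "\<And>m m'. m mod int n = m' mod int n \<Longrightarrow> P m \<Longrightarrow> P m'"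
  shows "P m"
proof -
  have "P (m0 + int k)" for k
  proof (induction k)
    case (Suc k)
    then show ?case using step[of "m0 + int k"] by (simp add: add_ac)
  qed (simp add: assms(1))
  then have "P (m0 + (m - m0) mod int n)"
    using zero_le_imp_eq_int[of "(m - m0) mod int n"] by fastforce
  then show ?thesis
    by (rule mod[rotated]) (simp add: mod_add_right_eq)
qed

text \<open>If G fixes 1, then G^m fixes 1 for all \<open>m\<close>, and G carries each level into
  itself up to a nonzero scalar. Level 1 vanishes at one frequency, hence at all of them; higher
  levels follow by acting with X.\<close>

lemma coact_global:
  assumes coact and A1: "E 1 0 1 = 1" and "j < n"
  shows "E m j 1 = (if j = 0 then 1 else 0)"
proof -
  note co = \<open>coact\<close>
  have shift: "E 1 0 (E m j a) = sc (q powi (- int j)) (E (m + 1) j a)" if "j < n" for m j a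
    using coact_coassoc_0[OF co that, of 1 m a] by (simp add: A1 add.commute)
  have level0: "E m 0 1 = 1" for m
  proof (rule periodic_induct[where P = "\<lambda>m. E m 0 1 = 1"])
    show "E (m + 1) 0 1 = 1" if "E m 0 1 = 1" for m
      using shift[of 0 m 1] that by (simp add: A1)
    show "E m' 0 1 = 1" if "m mod int n = m' mod int n" "E m 0 1 = 1" for m m'
      using that by (simp add: E_cong_mod[of m m'])
  qed (rule A1)
  have level1: "E m 1 1 = 0" for m
  proof (rule periodic_induct[where P = "\<lambda>m. E m 1 1 = 0"])
    \<comment> \<open>Acting with X on \<open>E 1 0 1 = 1\<close> gives \<open>E 1 1 1\<close> on
      the left and \<open>E 2 1 1 + E 1 1 1\<close> on the right.\<close>
    show "E (1 + 1) 1 1 = 0"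
      using coact_coassoc_1[OF co n_pos, of 1 1 1] by (simp add: A1 qnum_Suc)
    show "E (m + 1) 1 1 = 0" if "E m 1 1 = 0" for m
      using shift[of 1 m 1] that n2 by simp
    show "E m' 1 1 = 0" if "m mod int n = m' mod int n" "E m 1 1 = 0" for m m'
      using that by (simp add: E_cong_mod[of m m'])
  qed
  have "0 < j \<longrightarrow> (\<forall>m. E m j 1 = 0)"
    using \<open>j < n\<close>
  proof (induction j)
    case (Suc j)
    show ?case
    proof (cases "j = 0")
      case True
      then show ?thesis using level1 by simp
    next
      case False
      with Suc have "E m j 1 = 0" for m by simp
      then have "E (1 + m) (Suc j) 1 = 0" for m
        using coact_coassoc_1[of j 1 m 1] co Suc.prems A1 level1 qnum_nz[of "Suc j"] by simp
      from this[of "m - 1" for m] show ?thesis by simp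
    qed
  qed simp
  then show ?thesis using level0 by simp
qed

text \<open>When G kills 1, the element X G^(-1), which is \<open>E 0 1\<close>, acts as right
  multiplication by \<open>- w\<close>. Inserting this into the partial action law gives the
  recursion.\<close>

lemma coact_skew_rec:
  assumes coact and A1: "E 1 0 1 = 0"
  shows "skew_rec (E 1 1 1) (\<lambda>m j. E m j a)"
proof -
  note co = \<open>coact\<close>
  \<comment> \<open>Expand \<open>E 0 1 (E 1 0 1)\<close>, which is zero because
    \<open>E 1 0 1 = 0\<close>.\<close>
  have w: "E 0 1 1 = - E 1 1 1"
    using coact_coassoc_1[OF co n_pos, of 0 1 1] co
    by (simp add: A1 coact_counit qnum_Suc eq_neg_iff_add_eq_0 add.commute)
  have m1: "E (- 1) 0 1 = 0"
    using coact_coassoc_0[OF co n_pos, of "- 1" 1 1] co by (simp add: A1 coact_counit)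
  \<comment> \<open>Multiplicativity on \<open>b * 1\<close>: the term containing
    \<open>E 0 1 b\<close> has the factor \<open>E (- 1) 0 1\<close>, which vanishes by
    \<open>m1\<close>.\<close>
  have E01: "E 0 1 b = - (b * E 1 1 1)" for b
    using coact_mult[OF co, of 1 0 b 1] n2 co by (simp add: m1 w[unfolded One_nat_def] coact_counit)
  show ?thesis
    unfolding skew_rec_def
  proof (intro allI)
    fix m j
    show "sc (qnum q (Suc j)) (E (m + 1) (Suc j) a) = sc (q ^ j) (E 1 1 1 * E m j a) - E (m + 1) j a * E 1 1 1"
    proof (cases "j < n")
      case True
      show ?thesis
        using coact_coassoc_1[OF co True, of 0 "m + 1" a] co
        unfolding E01 by (simp add: coact_counit algebra_simps)
    qed (simp add: E_eq_0)
  qed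
qed

text \<open>Move G^m past X and expand by the recursion: one term vanishes because
  \<open>A_m * A_(m+1)\<close> is the action of G^m on \<open>A_1 = 0\<close>, and in the other
  \<open>cyc_absorb\<close> removes the right factor \<open>A_m\<close>.\<close>

lemma coact_skew_w:
  assumes coact and A1: "E 1 0 1 = 0"
  shows "E m 0 (E 1 1 1) = sc (q powi (- m)) (E m 0 1 * E 1 1 1)"
proof -
  note co = \<open>coact\<close>
  let ?A = "E m 0 1"
  have "E m 0 (E 1 1 1) = sc (q powi (- m)) (?A * E (m + 1) 1 1)"
    using coact_coassoc_0[OF co, of 1 m 1 1] n2 by simp
  also have "E (m + 1) 1 1 = E 1 1 1 * ?A - E (m + 1) 0 1 * E 1 1 1"
    using skew_recD[OF coact_skew_rec[OF assms], of 0 m 1] by (simp add: qnum_Suc)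
  also have "?A * \<dots> = ?A * E 1 1 1 * ?A - ?A * E (m + 1) 0 1 * E 1 1 1"
    by (simp add: right_diff_distrib mult.assoc)
  also have "?A * E (m + 1) 0 1 = 0"
    using coact_coassoc_0[OF co n_pos, of m 1 1] by (simp add: A1)
  also have "?A * E 1 1 1 * ?A = ?A * E 1 1 1"
    by (rule cyc_absorb[OF coact_imp_cyc_coact[OF co]])
  finally show ?thesis by simp
qed

text \<open>Both sides of the multiplicativity law and of the partial action law solve the skew
  recursion in \<open>(m, j)\<close>, so by \<open>skew_rec_unique\<close> it suffices to compare
  them at \<open>j = 0\<close>.\<close>

lemma coact_of_skew_rec:
  assumes cyc: cyc_coact and rec: "\<And>a. skew_rec w (\<lambda>m j. E m j a)"
    and w: "\<And>m. E m 0 w = sc (q powi (- m)) (E m 0 1 * w)"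
  shows coact
proof -
  have mult: "E m j (a * c) = (\<Sum>s\<le>j. E m s a * E (m - int s) (j - s) c)" if "j < n" for a c m j
    by (rule skew_rec_unique[OF rec skew_rec_convolution[OF rec rec] _ that])
      (simp add: cyc_mult[OF cyc])
  \<comment> \<open>The comparison at level 0 for the partial action law. It is not a case of
    uniqueness in \<open>(m, j)\<close> and is proved by applying G^m to the recursion for
    \<open>E m' j a\<close>.\<close>
  have level0: "E m 0 (E m' j a) = sc (q powi (- (m * int j))) (E m 0 1 * E (m + m') j a)"
    if "j < n" for m m' j a
    using that
  proof (induction j arbitrary: m')
    case 0
    then show ?case by (simp add: cyc_coassoc[OF cyc])
  next
    case (Suc j)
    let ?A = "E m 0 1" and ?c = "q powi (- (m * int j))" and ?m = "m' - 1"
    have IH: "E m 0 (E m' j a) = sc ?c (?A * E (m + m') j a)" for m'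
      using Suc by simp
    have c: "q powi (- (m * int (Suc j))) = q powi (- m) * ?c"
      by (simp add: algebra_simps flip: powi_add)
    \<comment> \<open>Applying G^m to a product leaves a factor \<open>?A\<close> in each factor;
      these rules delete the inner one.\<close>
    have absorb: "?A * (b * ?A) = ?A * b" "?A * (b * (?A * d)) = ?A * (b * d)" for b d
      using cyc_absorb[OF cyc, of m b] by (simp_all flip: mult.assoc)
    have "sc (qnum q (Suc j)) (E m 0 (E (?m + 1) (Suc j) a))
        = E m 0 (sc (q ^ j) (w * E ?m j a) - E (?m + 1) j a * w)"
      using skew_recD[OF rec[of a], of j ?m] by (metis E_scale)
    also have "\<dots> = sc (q ^ j) (E m 0 w * E m 0 (E ?m j a)) - E m 0 (E (?m + 1) j a) * E m 0 w"
      by (simp only: E_diff E_scale cyc_mult[OF cyc])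
    also have "\<dots> = sc (q powi (- m) * ?c)
        (?A * (sc (q ^ j) (w * E (m + ?m) j a) - E (m + (?m + 1)) j a * w))"
      unfolding IH w
      by (simp add: sc_mult_left sc_mult_right right_diff_distrib scale_right_diff_distrib
          mult.assoc absorb ac_simps del: diff_add_cancel)
    also have "\<dots> = sc (q powi (- m) * ?c) (?A * sc (qnum q (Suc j)) (E (m + ?m + 1) (Suc j) a))"
      unfolding skew_recD[OF rec] by (simp add: add.assoc)
    finally have "sc (qnum q (Suc j)) (E m 0 (E m' (Suc j) a))
        = sc (qnum q (Suc j)) (sc (q powi (- m) * ?c) (?A * E (m + m') (Suc j) a))"
      by (simp add: sc_mult_right mult.commute)
    then show ?case
      using qnum_nz[of "Suc j"] Suc.prems unfolding c by (simp del: scale_scale)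
  qed
  have "E m j (E m' j' a)
      = (\<Sum>s\<le>j. E m s 1 * sc (q powi (- ((m - int s) * int j')) * qbinom q (j - s + j') j')
          (E (m - int s + m') (j - s + j') a))" if "j < n" "j' < n" for m m' j j' a
    by (rule skew_rec_unique[OF rec skew_rec_convolution[OF rec skew_rec_shift[OF rec]] _ \<open>j < n\<close>])
      (simp add: level0[OF \<open>j' < n\<close>] sc_mult_right)
  with mult show ?thesis
    by (simp add: coact_def cyc_counit[OF cyc])
qed

section \<open>Formula (i) as an inverse Fourier transform\<close>

definition rebuilt :: "'a \<Rightarrow> 'a \<Rightarrow> nat \<times> nat \<Rightarrow> 'a" where
  "rebuilt w a = (\<Sum>i<n. \<Sum>j<n. \<Sum>k\<le>j.
     tensor sc
       (sc (q powi (- int (i * j)) * (-1) ^ k * q powi (- int (k * (k - 1) div 2))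
            * qbinom (inverse q) j k)
          (w ^ (j - k)
           * (\<Sum>t<n. sc (q powi (- int ((i + k) * t))) (\<rho> a (t, 0)))
           * w ^ k))
       (\<lambda>(l, j'). if l < n \<and> j' = j
          then inverse (of_nat n) * inverse (qfact q j)
               * q ^ (i * j + j * (j - 1) div 2) * q ^ (l * (i + j))
          else 0))"

text \<open>The powers of \<open>q\<close> in exponent \<open>i * j\<close> cancel, and q^(l(i+j))
  is the inversion kernel at frequency \<open>i + j\<close>. Hence each coordinate is an inverse
  transform over the window starting at \<open>j\<close>.\<close>

lemma rebuilt_coordinate:
  assumes "l < n" "j < n"
  shows "rebuilt w a (l, j) = sc (inverse (of_nat n)) (\<Sum>i<n. sc (q powi ((int i + int j) * int l))
    (sc (inverse (skew_scale j)) (skew_form w (\<lambda>m. E m 0 a) (int i) j)))"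
proof -
  let ?K = "\<lambda>i. inverse (of_nat n) * inverse (qfact q j) * q ^ (i * j + j * (j - 1) div 2) * q ^ (l * (i + j))"
  let ?X = "\<lambda>i k. w ^ (j - k) * E (int i + int k) 0 a * w ^ k"
  have E: "(\<Sum>t<n. sc (q powi (- int ((i + k) * t))) (\<rho> a (t, 0))) = E (int i + int k) 0 a" for i k
    by (simp add: E_def hat_def dft_def)
  have scalar: "?K i * (q powi (- int (i * j)) * c)
      = inverse (of_nat n) * (q powi ((int i + int j) * int l) * (inverse (skew_scale j) * c))" for i c
  proof -
    have "q ^ (i * j) * q powi (- int (i * j)) = 1"
      by (simp add: power_int_minus del: of_nat_mult)
    moreover have "q ^ (l * (i + j)) = q powi ((int i + int j) * int l)"
      by (simp add: mult.commute flip: power_int_of_nat)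
    moreover have "inverse (skew_scale j) = inverse (qfact q j) * q ^ (j * (j - 1) div 2)"
      by (simp add: skew_scale_def power_int_minus)
    ultimately show ?thesis by (simp add: power_add ac_simps)
  qed
  have "rebuilt w a (l, j) = (\<Sum>i<n. \<Sum>j'<n. if j' = j
      then \<Sum>k\<le>j. sc (?K i) (sc (q powi (- int (i * j)) * skew_coeff j k) (?X i k)) else 0)"
    unfolding rebuilt_def sum_fun_apply E
    using assms by (intro sum.cong refl) (auto simp: tensor_def skew_coeff_def mult.assoc)
  also have "\<dots> = (\<Sum>i<n. \<Sum>k\<le>j. sc (?K i) (sc (q powi (- int (i * j)) * skew_coeff j k) (?X i k)))"
    using assms by simp
  also have "\<dots> = sc (inverse (of_nat n)) (\<Sum>i<n. sc (q powi ((int i + int j) * int l))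
    (sc (inverse (skew_scale j)) (skew_form w (\<lambda>m. E m 0 a) (int i) j)))"
    unfolding skew_form_def scale_sum_right scale_scale scalar ..
  finally show ?thesis .
qed

lemma rebuilt_outside: "b \<notin> taft_basis n \<Longrightarrow> rebuilt w a b = 0"
  unfolding rebuilt_def sum_fun_apply
  by (cases b) (auto simp: taft_basis_def tensor_def intro!: sum.neutral)

text \<open>By Fourier inversion, condition (i) says exactly that the action of X^j G^i is given by
  \<open>skew_form\<close>.\<close>

lemma rebuilt_iff:
  "\<rho> a = rebuilt w a \<longleftrightarrow>
    (\<forall>i j. j < n \<longrightarrow> skew_form w (\<lambda>m. E m 0 a) i j = sc (skew_scale j) (E (i + int j) j a))"
proof
  assume eq: "\<rho> a = rebuilt w a"
  have nat: "skew_form w (\<lambda>m. E m 0 a) (int i) j = sc (skew_scale j) (E (int i + int j) j a)"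
    if "i < n" "j < n" for i j
  proof -
    let ?X = "\<lambda>i. sc (inverse (skew_scale j)) (skew_form w (\<lambda>m. E m 0 a) (int i) j)"
    have "E (int i + int j) j a = dft (\<lambda>l. rebuilt w a (l, j)) (int i + int j)"
      by (simp add: E_def hat_def flip: eq)
    also have "\<dots> = dft (\<lambda>l. sc (inverse (of_nat n))
        (\<Sum>i<n. sc (q powi ((int i + int j) * int l)) (?X i))) (int i + int j)"
      using that by (intro dft_cong rebuilt_coordinate)
    also have "\<dots> = ?X i"
      using that by (intro dft_inverse')
    finally show ?thesis using skew_scale_nz[OF \<open>j < n\<close>] by simp
  qed
  show "\<forall>i j. j < n \<longrightarrow> skew_form w (\<lambda>m. E m 0 a) i j = sc (skew_scale j) (E (i + int j) j a)"
  proof (intro allI impI)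
    fix i j assume "j < n"
    \<comment> \<open>Inversion covers the frequencies with \<open>i\<close> in 0..n-1; all other
      integers reduce to these by periodicity.\<close>
    define i' where "i' = nat (i mod int n)"
    have i': "i' < n" "int i' mod int n = i mod int n"
      by (simp_all add: i'_def nat_less_iff)
    have "E (i + c) j' a = E (int i' + c) j' a" for c j'
      using i'(2) by (intro E_cong_mod) (metis mod_add_left_eq)
    then show "skew_form w (\<lambda>m. E m 0 a) i j = sc (skew_scale j) (E (i + int j) j a)"
      using nat[OF i'(1) \<open>j < n\<close>] by (simp add: skew_form_def)
  qed
next
  assume eq: "\<forall>i j. j < n \<longrightarrow> skew_form w (\<lambda>m. E m 0 a) i j = sc (skew_scale j) (E (i + int j) j a)"
  have "\<rho> a (l, j) = rebuilt w a (l, j)" for l j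
  proof (cases "l < n \<and> j < n")
    case True
    then have "sc (inverse (skew_scale j)) (skew_form w (\<lambda>m. E m 0 a) (int i) j) = E (int i + int j) j a" for i
      by (simp add: eq skew_scale_nz)
    then show ?thesis
      using True dft_inverse[of l "\<lambda>l. \<rho> a (l, j)" "int j"]
      by (simp only: rebuilt_coordinate) (simp only: E_def hat_def)
  next
    case False
    then have "(l, j) \<notin> taft_basis n" by (auto simp: taft_basis_def)
    then show ?thesis by (simp add: supp rebuilt_outside)
  qed
  then show "\<rho> a = rebuilt w a" by auto
qed

lemma global_of_unit:
  assumes "\<And>m j. j < n \<Longrightarrow> E m j 1 = (if j = 0 then 1 else 0)" and b: "b \<in> taft_basis n"
  shows "\<rho> 1 b = sc (taft_one b) 1"
proof -
  obtain l j where lj: "b = (l, j)" "l < n" "j < n"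
    using b by (auto simp: taft_basis_def)
  have "dft (\<lambda>l. sc (taft_one (l, j)) 1) m = (if j = 0 then 1 else 0)" for m
    by (cases "j = 0") (simp_all add: dft_def taft_one_def if_distrib[of "sc _"] if_distribR
        if_distrib[of "\<lambda>c. sc c _"] cong: if_cong)
  then have "\<forall>m. dft (\<lambda>l. \<rho> 1 (l, j)) m = dft (\<lambda>l. sc (taft_one (l, j)) 1) m"
    using assms(1)[OF lj(3)] by (simp add: E_def hat_def)
  then show ?thesis
    unfolding dft_eq_iff using lj by simp
qed

text \<open>Forward, the recursion forced by \<open>A_1 = 0\<close> yields (i), (ii) and (iii).
  Backward, (i) and (ii) restore the recursion, and (iii) supplies the action of G^m on
  \<open>w\<close> from which the axioms propagate.\<close>

theorem coact_iff:
  assumes A1: "E 1 0 1 = 0"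
  defines "w \<equiv> E 1 1 1"
  shows "coact \<longleftrightarrow> cyc_coact \<and> (\<forall>a. \<rho> a = rebuilt w a) \<and> (\<forall>b. w ^ n * b = b * w ^ n) \<and>
    (\<forall>i<n. E (int i) 0 w = sc (q powi (- int i)) (E (int i) 0 1 * w))"
    (is "_ \<longleftrightarrow> ?rhs")
proof
  assume co: coact
  have rec: "skew_rec w (\<lambda>m j. E m j a)" for a
    unfolding w_def using co A1 by (rule coact_skew_rec)
  have form: "skew_form w (\<lambda>m. E m 0 a) i j = sc (skew_scale j) (E (i + int j) j a)" for a i j
    using rec by (rule skew_form_eq_of_rec)
  \<comment> \<open>Read the closed form at level \<open>n\<close>, where \<open>E\<close> vanishes,
    with frequency 0.\<close>
  have "w ^ n * b = b * w ^ n" for b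
  proof -
    have "E (int n) 0 b = b"
      using E_cong_mod[of "int n" 0 0 b] co by (simp add: coact_counit)
    then show ?thesis
      using form[of b 0 n] co by (simp add: skew_form_n E_eq_0 coact_counit)
  qed
  moreover have "E m 0 w = sc (q powi (- m)) (E m 0 1 * w)" for m
    unfolding w_def using co A1 by (rule coact_skew_w)
  ultimately show ?rhs
    using coact_imp_cyc_coact[OF co] form by (simp add: rebuilt_iff)
next
  assume rhs: ?rhs
  show coact
  proof (rule coact_of_skew_rec[of w])
    show "skew_rec w (\<lambda>m j. E m j a)" for a
      using rhs
      by (intro rec_of_skew_form_eq[where f = "\<lambda>m. E m 0 a"]) (auto simp: rebuilt_iff E_eq_0 intro: E_cong_mod)
    show "E m 0 w = sc (q powi (- m)) (E m 0 1 * w)" for m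
    proof -
      define i where "i = nat (m mod int n)"
      have i: "i < n" "int i mod int n = m mod int n"
        by (simp_all add: i_def nat_less_iff)
      have "q powi (- int i) = q powi (- m)"
        using i(2) by (intro powi_cong mod_minus_cong)
      then show ?thesis
        using rhs i E_cong_mod[OF i(2), of 0] by metis
    qed
  qed (use rhs in simp)
qed

end

theorem theorem3p19:
  fixes sc :: "'k::field \<Rightarrow> 'a::{ring,monoid_mult} \<Rightarrow> 'a"
    and n :: nat and q :: 'k
    and \<rho> :: "'a \<Rightarrow> nat \<times> nat \<Rightarrow> 'a"
    and Aop :: "nat \<Rightarrow> 'a" and w :: 'a
  assumes alg: "k_algebra sc"
    and n2: "n \<ge> 2"
    and prim: "q ^ n = 1" "\<forall>m. 0 < m \<and> m < n \<longrightarrow> q ^ m \<noteq> 1"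
    and supp: "\<forall>a b. b \<notin> taft_basis n \<longrightarrow> \<rho> a b = 0"
    and lin_add: "\<forall>a b. \<rho> (a + b) = \<rho> a + \<rho> b"
    and lin_sc: "\<forall>c a. \<rho> (sc c a) = (\<lambda>b. sc c (\<rho> a b))"
    and Aop_def: "\<forall>i. Aop i = (\<Sum>r<n. sc (q powi (- int (i * r))) (\<rho> 1 (r, 0)))"
    and w_def: "w = (\<Sum>k<n. sc (q powi (- int k)) (\<rho> 1 (k, 1)))"
    and A1: "Aop 1 = 0 \<or> Aop 1 = 1"
  shows "partial_coaction sc (taft_basis n) (taft_mu n q) (taft_delta n q) taft_eps taft_one \<rho>
    \<longleftrightarrow>
    global_coaction sc (taft_basis n) (taft_mu n q) (taft_delta n q) taft_eps taft_one \<rho>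
    \<or>
    (partial_coaction sc {..<n} (cyc_mu n) cyc_delta cyc_eps cyc_one (proj_pi \<rho>)
     \<and> Aop 1 = 0
     \<and> (\<forall>a. \<rho> a =
          (\<Sum>i<n. \<Sum>j<n. \<Sum>k\<le>j.
             tensor sc
               (sc (q powi (- int (i * j)) * (-1) ^ k * q powi (- int (k * (k - 1) div 2))
                    * qbinom (inverse q) j k)
                  (w ^ (j - k)
                   * (\<Sum>t<n. sc (q powi (- int ((i + k) * t))) (\<rho> a (t, 0)))
                   * w ^ k))
               (\<lambda>(l, j'). if l < n \<and> j' = j
                  then inverse (of_nat n) * inverse (qfact q j)
                       * q ^ (i * j + j * (j - 1) div 2) * q ^ (l * (i + j))
                  else 0)))
     \<and> (\<forall>b. w ^ n * b = b * w ^ n)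
     \<and> (\<forall>i<n. (\<Sum>s<n. sc (q powi (- int (i * s))) (\<rho> w (s, 0))) = sc (q powi (- int i)) (Aop i * w)))"
proof -
  interpret taft_map n q sc \<rho>
    using assms by unfold_locales (auto simp: k_algebra_def)
  have Aop: "Aop i = E (int i) 0 1" for i
    by (simp add: Aop_def E_def hat_def dft_def)
  have w: "w = E 1 1 1"
    by (simp add: w_def E_def hat_def dft_def)
  have Ew: "(\<Sum>s<n. sc (q powi (- int (i * s))) (\<rho> w (s, 0))) = E (int i) 0 w" for i
    by (simp add: E_def hat_def dft_def)
  have "global_coaction sc (taft_basis n) (taft_mu n q) (taft_delta n q) taft_eps taft_one \<rho>"
    if coact "Aop 1 = 1"
    unfolding global_coaction_def partial_coaction_taft_iff
    using that global_of_unit coact_global by (simp add: Aop)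
  moreover have "coact"
    if "global_coaction sc (taft_basis n) (taft_mu n q) (taft_delta n q) taft_eps taft_one \<rho>"
    using that by (simp add: global_coaction_def partial_coaction_taft_iff)
  moreover have "coact \<longleftrightarrow> cyc_coact \<and> (\<forall>a. \<rho> a = rebuilt w a) \<and> (\<forall>b. w ^ n * b = b * w ^ n) \<and>
    (\<forall>i<n. E (int i) 0 w = sc (q powi (- int i)) (Aop i * w))" if "Aop 1 = 0"
    unfolding w Aop using that by (intro coact_iff) (simp add: Aop)
  \<comment> \<open>For \<open>A_1 = 1\<close> a partial coaction is global, for
    \<open>A_1 = 0\<close> the second alternative characterizes it, and a global coaction is partial
    in either case.\<close>
  ultimately show ?thesis
    unfolding partial_coaction_taft_iff partial_coaction_cyc_iff rebuilt_def[symmetric] Ew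
    using A1 by blast
qed

end
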